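(* There is an algorithm that, given an instance $(S,k)$ of MaxLin2-AA[$k$] in which $S$ has $n$ variables and $m$ equations, runs in time $n^{2k}(nm)^{O(1)}$ and returns an assignment $x^0\in\{-1,1\}^n$ with $\varepsilon_S(x^0)\ge 2k$ if such an assignment exists, and returns NO otherwise.
   Context: An instance of MaxLin2-AA consists of a system $S$ of $m$ equations $\prod_{i\in I_j}x_i=b_j$, $j=1,\dots,m$, in variables $x_1,\dots,x_n$, where $\emptyset\ne I_j\subseteq[n]$ and $x_i,b_j\in\{-1,1\}$; equation $j$ has a positive integral weight $w_j$; and a nonnegative integer $k$ (the parameter). Let $W=\sum_j w_j$ and let $\mathrm{sat}(S)$ be the maximum total weight of simultaneously satisfiable equations; the question is whether $\mathrm{sat}(S)\ge W/2+k$. The excess of an assignment $x^0\in\{-1,1\}^n$ is $\varepsilon_S(x^0)=\sum_{j=1}^m w_jb_j\prod_{i\in I_j}x^0_i$, i.e. the total weight of satisfied equations minus the total weight of falsified equations. *)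

theory Defs
  imports Main
begin

record equation =
  lhs_vars :: "nat set"
  rhs :: int
  weight :: int

record lin_system =
  num_vars :: nat
  equations :: "equation list"

definition num_eqs :: "lin_system \<Rightarrow> nat" where
  "num_eqs S = length (equations S)"

definition wf_system :: "lin_system \<Rightarrow> bool" where
  "wf_system S \<longleftrightarrow> (\<forall>e \<in> set (equations S).
     lhs_vars e \<noteq> {} \<and> lhs_vars e \<subseteq> {1..num_vars S} \<and> rhs e \<in> {-1, 1} \<and> weight e > 0)"

text \<open>Only the values at \<open>1, \<dots>, num_vars S\<close> are relevant.\<close>

definition is_assignment :: "lin_system \<Rightarrow> (nat \<Rightarrow> int) \<Rightarrow> bool" where
  "is_assignment S x \<longleftrightarrow> (\<forall>i \<in> {1..num_vars S}. x i \<in> {-1, 1})"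

definition excess :: "lin_system \<Rightarrow> (nat \<Rightarrow> int) \<Rightarrow> int" where
  "excess S x = (\<Sum>j<num_eqs S. weight (equations S ! j) * rhs (equations S ! j) *
                   (\<Prod>i\<in>lhs_vars (equations S ! j). x i))"

text \<open>
  A structured random access machine. A program works on finitely many named arrays of integers,
  with arbitrary computed indices. Its arithmetic is restricted to addition and subtraction: at
  unit cost, these make the machine polynomially equivalent to Turing machines (for inputs whose
  size counts the bits of the numbers), whereas unit-cost multiplication would not. Running time is
  the number of elementary operations performed; an operation on a number takes one step
  irrespective of its magnitude, so the size of the weights does not enter.
\<close>

type_synonym vname = string
type_synonym store = "vname \<Rightarrow> int \<Rightarrow> int"

datatype aexp = N int | Cell vname aexp | Plus aexp aexp | Minus aexp aexp
datatype bexp = Less aexp aexp | BNot bexp | BAnd bexp bexp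

text \<open>\<open>Assign a e e'\<close> is the array update \<open>a[e] := e'\<close>.\<close>

datatype com =
    Skip
  | Assign vname aexp aexp
  | Seq com com
  | Cond bexp com com
  | While bexp com

text \<open>A scalar variable is cell 0 of its array.\<close>

abbreviation Var :: "vname \<Rightarrow> aexp" where
  "Var a \<equiv> Cell a (N 0)"

fun aval :: "aexp \<Rightarrow> store \<Rightarrow> int" where
  "aval (N c) s = c"
| "aval (Cell a e) s = s a (aval e s)"
| "aval (Plus e e') s = aval e s + aval e' s"
| "aval (Minus e e') s = aval e s - aval e' s"

fun bval :: "bexp \<Rightarrow> store \<Rightarrow> bool" where
  "bval (Less e e') s \<longleftrightarrow> aval e s < aval e' s"
| "bval (BNot b) s \<longleftrightarrow> \<not> bval b s"
| "bval (BAnd b b') s \<longleftrightarrow> bval b s \<and> bval b' s"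

fun acost :: "aexp \<Rightarrow> nat" where
  "acost (N c) = 1"
| "acost (Cell a e) = 1 + acost e"
| "acost (Plus e e') = 1 + acost e + acost e'"
| "acost (Minus e e') = 1 + acost e + acost e'"

fun bcost :: "bexp \<Rightarrow> nat" where
  "bcost (Less e e') = 1 + acost e + acost e'"
| "bcost (BNot b) = 1 + bcost b"
| "bcost (BAnd b b') = 1 + bcost b + bcost b'"

text \<open>\<open>exec c s t s'\<close>: started in \<open>s\<close>, the program \<open>c\<close> halts after \<open>t\<close> steps in \<open>s'\<close>.\<close>

inductive exec :: "com \<Rightarrow> store \<Rightarrow> nat \<Rightarrow> store \<Rightarrow> bool" where
  Skip: "exec Skip s 1 s"
| Assign: "exec (Assign a e e') s (1 + acost e + acost e')
             (s(a := (s a)(aval e s := aval e' s)))"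
| Seq: "exec c1 s t1 s' \<Longrightarrow> exec c2 s' t2 s'' \<Longrightarrow> exec (Seq c1 c2) s (t1 + t2) s''"
| CondTrue: "bval b s \<Longrightarrow> exec c1 s t s' \<Longrightarrow> exec (Cond b c1 c2) s (1 + bcost b + t) s'"
| CondFalse: "\<not> bval b s \<Longrightarrow> exec c2 s t s' \<Longrightarrow> exec (Cond b c1 c2) s (1 + bcost b + t) s'"
| WhileFalse: "\<not> bval b s \<Longrightarrow> exec (While b c) s (1 + bcost b) s"
| WhileTrue: "bval b s \<Longrightarrow> exec c s t1 s' \<Longrightarrow> exec (While b c) s' t2 s'' \<Longrightarrow>
    exec (While b c) s (1 + bcost b + t1 + t2) s''"

inductive_cases SkipE: "exec Skip s t s'"
inductive_cases AssignE: "exec (Assign a e e') s t s'"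
inductive_cases SeqE: "exec (Seq c1 c2) s t s'"
inductive_cases CondE: "exec (Cond b c1 c2) s t s'"
inductive_cases WhileE: "exec (While b c) s t s'"

text \<open>Hence the existence of a terminating run determines both the running time and the output.\<close>

lemma exec_deterministic:
  assumes "exec c s t s'" and "exec c s u r"
  shows "t = u \<and> s' = r"
  using assms
proof (induction arbitrary: u r rule: exec.induct)
  case (Skip s)
  from Skip.prems show ?case by (rule SkipE) simp
next
  case (Assign a e e' s)
  from Assign.prems show ?case by (rule AssignE) simp
next
  case (Seq c1 s t1 s' c2 t2 s'')
  from Seq.prems obtain v1 q v2
    where *: "u = v1 + v2" "exec c1 s v1 q" "exec c2 q v2 r" by (rule SeqE)
  from Seq.IH(1)[OF *(2)] have "t1 = v1" "s' = q" by simp_all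
  with Seq.IH(2)[of v2 r] * show ?case by simp
next
  case (CondTrue b s c1 t s' c2)
  from CondTrue.prems obtain v
    where *: "u = 1 + bcost b + v" "exec c1 s v r" by (rule CondE) (use CondTrue.hyps in simp_all)
  from CondTrue.IH[OF *(2)] * show ?case by simp
next
  case (CondFalse b s c2 t s' c1)
  from CondFalse.prems obtain v
    where *: "u = 1 + bcost b + v" "exec c2 s v r" by (rule CondE) (use CondFalse.hyps in simp_all)
  from CondFalse.IH[OF *(2)] * show ?case by simp
next
  case (WhileFalse b s c)
  from WhileFalse.prems show ?case by (rule WhileE) (use WhileFalse.hyps in simp_all)
next
  case (WhileTrue b s c t1 s' t2 s'')
  from WhileTrue.prems obtain v1 q v2
    where *: "u = 1 + bcost b + v1 + v2" "exec c s v1 q" "exec (While b c) q v2 r"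
    by (rule WhileE) (use WhileTrue.hyps in simp_all)
  from WhileTrue.IH(1)[OF *(2)] have "t1 = v1" "s' = q" by simp_all
  with WhileTrue.IH(2)[of v2 r] * show ?case by simp
qed

text \<open>
  An instance is presented by the scalars \<open>n\<close>, \<open>m\<close>, \<open>k\<close>, the \<open>m \<times> n\<close> incidence matrix \<open>A\<close> of
  equations and variables (in row-major order: \<open>A[j * n + i]\<close> tells whether variable \<open>i + 1\<close> occurs
  in equation number \<open>j\<close>, both \<open>i\<close> and \<open>j\<close> counted from 0), and the arrays \<open>b\<close> and \<open>w\<close> of right-hand
  sides and weights. All other cells are 0.
\<close>

definition input_store :: "lin_system \<Rightarrow> nat \<Rightarrow> store" where
  "input_store S k = (\<lambda>a i.
     let n = num_vars S; m = num_eqs S in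
     if a = ''n'' \<and> i = 0 then int n
     else if a = ''m'' \<and> i = 0 then int m
     else if a = ''k'' \<and> i = 0 then int k
     else if a = ''A'' \<and> 0 \<le> i \<and> i < int (m * n)
       then of_bool (nat i mod n + 1 \<in> lhs_vars (equations S ! (nat i div n)))
     else if a = ''b'' \<and> 0 \<le> i \<and> i < int m then rhs (equations S ! nat i)
     else if a = ''w'' \<and> 0 \<le> i \<and> i < int m then weight (equations S ! nat i)
     else 0)"

text \<open>
  The scalar \<open>found\<close> distinguishes the answer NO (\<open>None\<close>) from an assignment, whose value at variable
  \<open>i\<close> is read off from \<open>x[i]\<close>.
\<close>

definition answer :: "store \<Rightarrow> (nat \<Rightarrow> int) option" where
  "answer s = (if s ''found'' 0 = 0 then None else Some (\<lambda>i. s ''x'' (int i)))"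

end

theory Submission
  imports Defs
begin

text \<open>
  Combine equations with equal left-hand sides and drop those of total weight 0; let \<open>E\<close> be a
  maximal independent set of the remaining left-hand sides, so that \<open>|E| \<le> n\<close>. An assignment either
  falsifies all of \<open>E\<close>, which determines its excess, or satisfies some \<open>e \<in> E\<close>. Substituting
  the satisfied equation \<open>e\<close> makes it a constant of weight at least 1 and lowers the rank. After \<open>2k\<close> such
  substitutions the constant part of the excess is at least \<open>2k\<close>, and continuing to satisfy
  equations until none are left can only increase it. Hence it suffices to try
  the \<open>n\<^sup>D\<close> sequences of \<open>D = min(2k, n)\<close> choices of \<open>e\<close>, testing at every stage the assignment that
  falsifies all of \<open>E\<close>.

  Independence is decided by column operations over \<open>GF(2)\<close>, that is by changing variables so that the members of
  \<open>E\<close> become single variables; a choice of \<open>e\<close> is then a column number, and the sequences of choices are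
  enumerated by an \<open>n\<close>-ary counter.
\<close>

subsection \<open>Elimination and branching\<close>

text \<open>Correctness rests on following one unknown assignment \<open>z\<close> of excess at
  least \<open>2k\<close>. If the tested candidate is worse than \<open>z\<close>, then
  \<open>z\<close> cannot falsify every pivot, so some column number is a choice that
  \<open>z\<close> agrees with; hence one of the enumerated sequences tracks \<open>z\<close>. The
  constant part is 0 at the start, since no left-hand side is empty, and dropping classes of total
  weight 0 is what makes each substitution gain at least 1. Every choice also removes a variable,
  hence the cap by \<open>n\<close>: if \<open>n < 2k\<close>, nothing is left to branch on after
  \<open>n\<close> choices and the candidate itself is no worse than \<open>z\<close>. Wrong
  sequences are harmless, because every tested assignment is genuine and its excess is recomputed
  from the weights. The obstacle is that the changes of variables must be undone to report an
  answer; one extra row per original variable, carried through all operations, avoids any inversion.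
  As to time, all loops inside one trial have at most \<open>2n + m + 1\<close> rounds, so a trial
  is polynomial and the enumeration contributes the factor \<open>n ^ D\<close>.\<close>

definition signs :: "('a \<Rightarrow> int) \<Rightarrow> bool" where
  "signs y \<longleftrightarrow> (\<forall>p. y p = 1 \<or> y p = -1)"

definition val :: "(nat \<Rightarrow> nat set) \<Rightarrow> (nat \<Rightarrow> int) \<Rightarrow> (nat \<Rightarrow> int) \<Rightarrow> nat \<Rightarrow> int" where
  "val X \<sigma> y r = \<sigma> r * (\<Prod>p\<in>X r. y p)"

text \<open>
  The effect on the row \<open>Y\<close> of making the product over the row \<open>Z\<close> a variable in place of variable
  \<open>p \<in> Z\<close>.
\<close>

definition toggle :: "nat set \<Rightarrow> nat \<Rightarrow> nat set \<Rightarrow> nat set" where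
  "toggle Z p Y = {q. (q \<in> Y) \<noteq> (p \<in> Y \<and> q \<in> Z \<and> q \<noteq> p)}"

definition fix_rows :: "nat \<Rightarrow> (nat \<Rightarrow> nat set) \<Rightarrow> nat \<Rightarrow> nat set" where
  "fix_rows p X r = X r - {p}"

definition fix_signs :: "nat \<Rightarrow> int \<Rightarrow> (nat \<Rightarrow> nat set) \<Rightarrow> (nat \<Rightarrow> int) \<Rightarrow> nat \<Rightarrow> int" where
  "fix_signs p v X \<sigma> r = (if p \<in> X r then v * \<sigma> r else \<sigma> r)"

section \<open>Products of signs under a change of variables\<close>

lemma signs_sq: "signs y \<Longrightarrow> y p * y p = 1"
  unfolding signs_def by (metis mult_1 mult_minus1 minus_minus)

lemma prod_signs_sq: "signs y \<Longrightarrow> (\<Prod>p\<in>A. y p) * (\<Prod>p\<in>A. y p) = 1"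
  by (simp add: prod.distrib[symmetric] signs_sq)

lemma prod_signs: "signs y \<Longrightarrow> (\<Prod>p\<in>A. y p) = 1 \<or> (\<Prod>p\<in>A. y p) = -1"
  using prod_signs_sq[of y A] by (metis square_eq_1_iff)

text \<open>Common factors square to 1, so multiplying monomials in signs adds their supports over
  \<open>GF(2)\<close>.\<close>

lemma prod_sym_diff:
  assumes "finite A" "finite B" "signs y"
  shows "(\<Prod>p\<in>sym_diff A B. y p) = (\<Prod>p\<in>A. y p) * (\<Prod>p\<in>B. y p)"
proof -
  let ?P = "\<lambda>C. \<Prod>p\<in>C. y p"
  have 1: "?P A = ?P (A - B) * ?P (A \<inter> B)"
    using assms by (subst prod.union_disjoint[symmetric]) (auto intro!: prod.cong)
  have 2: "?P B = ?P (B - A) * ?P (A \<inter> B)"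
    using assms by (subst prod.union_disjoint[symmetric]) (auto intro!: prod.cong)
  have 3: "?P (sym_diff A B) = ?P (A - B) * ?P (B - A)"
    using assms by (subst prod.union_disjoint) auto
  show ?thesis unfolding 1 2 3 using prod_signs_sq[OF assms(3), of "A \<inter> B"]
    by (simp add: mult.assoc mult.left_commute)
qed

lemma signs_upd: "signs y \<Longrightarrow> v = 1 \<or> v = -1 \<Longrightarrow> signs (y(p := v))"
  by (auto simp: signs_def)

text \<open>Solving \<open>u = (product over Z)\<close> for \<open>y p\<close> gives
  \<open>y p = u\<close> times the product over \<open>Z - {p}\<close>. Substituting this into a row
  that contains \<open>p\<close> keeps \<open>p\<close>, now standing for \<open>u\<close>, and adds
  \<open>Z - {p}\<close> modulo 2.\<close>

lemma prod_toggle: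
  assumes fin: "finite Y" "finite Z" and "signs y" and "p \<in> Z"
  shows "(\<Prod>q\<in>toggle Z p Y. (y(p := \<Prod>i\<in>Z. y i)) q) = (\<Prod>q\<in>Y. y q)"
proof (cases "p \<in> Y")
  case False
  then have "toggle Z p Y = Y" by (auto simp: toggle_def)
  moreover have "(\<Prod>q\<in>Y. (y(p := \<Prod>i\<in>Z. y i)) q) = (\<Prod>q\<in>Y. y q)"
    using False by (intro prod.cong) auto
  ultimately show ?thesis by simp
next
  case True
  let ?D = "sym_diff (Y - {p}) (Z - {p})"
  have "toggle Z p Y = insert p ?D" using True by (auto simp: toggle_def)
  then have "(\<Prod>q\<in>toggle Z p Y. (y(p := \<Prod>i\<in>Z. y i)) q) =
      (\<Prod>i\<in>Z. y i) * (\<Prod>q\<in>?D. (y(p := \<Prod>i\<in>Z. y i)) q)"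
    using fin by (simp add: prod.insert)
  also have "(\<Prod>q\<in>?D. (y(p := \<Prod>i\<in>Z. y i)) q) = (\<Prod>q\<in>?D. y q)"
    by (intro prod.cong) auto
  also have "\<dots> = (\<Prod>q\<in>Y - {p}. y q) * (\<Prod>q\<in>Z - {p}. y q)"
    using assms by (intro prod_sym_diff) auto
  also have "(\<Prod>q\<in>Z. y q) * ((\<Prod>q\<in>Y - {p}. y q) * (\<Prod>q\<in>Z - {p}. y q)) =
      y p * (\<Prod>q\<in>Z - {p}. y q) * ((\<Prod>q\<in>Y - {p}. y q) * (\<Prod>q\<in>Z - {p}. y q))"
    using assms by (simp add: prod.remove[of Z p])
  also have "y p * (\<Prod>q\<in>Z - {p}. y q) * ((\<Prod>q\<in>Y - {p}. y q) * (\<Prod>q\<in>Z - {p}. y q)) =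
      (y p * (\<Prod>q\<in>Y - {p}. y q)) * ((\<Prod>q\<in>Z - {p}. y q) * (\<Prod>q\<in>Z - {p}. y q))"
    by (simp only: mult_ac)
  also have "\<dots> = (\<Prod>q\<in>Y. y q)"
    using prod_signs_sq[OF assms(3)] prod.remove[OF fin(1) True, of y] by simp
  finally show ?thesis .
qed

text \<open>\<open>toggle Z p\<close> is an involution. Injectivity keeps distinct classes of rows
  distinct, so that combined weights survive a change of variables.\<close>

lemma inj_toggle: "inj (toggle Z p)"
proof (rule injI)
  fix A B assume *: "toggle Z p A = toggle Z p B"
  have "toggle Z p (toggle Z p Y) = Y" for Y
    by (auto simp: toggle_def)
  then show "A = B" using * by metis
qed

lemma toggle_simps:
  "p \<notin> Y \<Longrightarrow> toggle Z p Y = Y"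
  "p \<in> Z \<Longrightarrow> toggle Z p Z = {p}"
  by (auto simp: toggle_def)

text \<open>The outcome of a scan that overwrites a variable, initially \<open>c\<close>, at every
  hit; the loops of the program do just this. With \<open>c = n\<close> the value \<open>n\<close>
  signals that there was no hit.\<close>

primrec latest :: "(nat \<Rightarrow> bool) \<Rightarrow> nat \<Rightarrow> nat \<Rightarrow> nat" where
  "latest P c 0 = c"
| "latest P c (Suc i) = (if P i then i else latest P c i)"

lemma latest_cases: "latest P c i < i \<and> P (latest P c i) \<or> latest P c i = c \<and> (\<forall>j<i. \<not> P j)"
  by (induction i) (auto simp: less_Suc_eq)

section \<open>Gaussian elimination on weighted classes of equations\<close>

locale elimination =
  fixes n m :: nat and w :: "nat \<Rightarrow> int"
begin

text \<open>The coefficient of the monomial \<open>Y\<close> in the excess, written as a multilinear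
  polynomial; \<open>coef X \<sigma> {}\<close> is its constant term.\<close>

definition coef :: "(nat \<Rightarrow> nat set) \<Rightarrow> (nat \<Rightarrow> int) \<Rightarrow> nat set \<Rightarrow> int" where
  "coef X \<sigma> Y = (\<Sum>r<m. if X r = Y then w r * \<sigma> r else 0)"

definition total :: "(nat \<Rightarrow> int) \<Rightarrow> int" where
  "total z = (\<Sum>j<m. w j * z j)"

text \<open>
  Rows below \<open>m\<close> are the equations (right-hand sides moved into \<open>\<sigma>\<close>), row \<open>m + i\<close> expresses the
  original variable number \<open>i\<close> in the current variables.
\<close>

definition reach :: "(nat \<Rightarrow> nat set) \<Rightarrow> (nat \<Rightarrow> int) \<Rightarrow> (nat \<Rightarrow> int) \<Rightarrow> bool" where
  "reach X \<sigma> z \<longleftrightarrow> (\<exists>y. signs y \<and> (\<forall>r<m+n. z r = val X \<sigma> y r))"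

definition bounded_rows :: "(nat \<Rightarrow> nat set) \<Rightarrow> bool" where
  "bounded_rows X \<longleftrightarrow> (\<forall>r<m+n. X r \<subseteq> {..<n})"

text \<open>The number of these variables takes the place of the rank as the measure that bounds the
  number of substitutions.\<close>

definition live :: "(nat \<Rightarrow> nat set) \<Rightarrow> nat set" where
  "live X = (\<Union>r<m+n. X r)"

definition column :: "(nat \<Rightarrow> nat set) \<Rightarrow> (nat \<Rightarrow> int) \<Rightarrow> nat \<Rightarrow> nat" where
  "column X g j = latest (\<lambda>i. i \<in> X j \<and> g i = 0) n n"

text \<open>
  The sign \<open>g p\<close> marks column \<open>p\<close> as a pivot and is the value of variable \<open>p\<close> that satisfies the
  combined equation \<open>{p}\<close>. Rows whose combined weight \<open>coef\<close> vanishes are never used as pivot rows.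
\<close>

primrec elim :: "(nat \<Rightarrow> nat set) \<Rightarrow> (nat \<Rightarrow> int) \<Rightarrow> nat \<Rightarrow> (nat \<Rightarrow> nat set) \<times> (nat \<Rightarrow> int)" where
  "elim X \<sigma> 0 = (X, \<lambda>_. 0)"
| "elim X \<sigma> (Suc j) = (case elim X \<sigma> j of (X', g) \<Rightarrow>
     let p = column X' g j; c = coef X' \<sigma> (X' j) in
     if p < n \<and> c \<noteq> 0 then (\<lambda>r. toggle (X' j) p (X' r), g(p := sgn c)) else (X', g))"

lemma finite_row: "bounded_rows X \<Longrightarrow> r < m + n \<Longrightarrow> finite (X r)"
  unfolding bounded_rows_def by (meson finite_lessThan finite_subset)

lemma total_coef: "total (val X \<sigma> y) = (\<Sum>Y\<in>X ` {..<m}. coef X \<sigma> Y * (\<Prod>p\<in>Y. y p))"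
proof -
  have "total (val X \<sigma> y) = (\<Sum>Y\<in>X ` {..<m}. \<Sum>r\<in>{r\<in>{..<m}. X r = Y}. w r * val X \<sigma> y r)"
    unfolding total_def by (rule sum.image_gen) simp
  also have "\<dots> = (\<Sum>Y\<in>X ` {..<m}. coef X \<sigma> Y * (\<Prod>p\<in>Y. y p))"
  proof (rule sum.cong)
    fix Y
    have "(\<Sum>r\<in>{r\<in>{..<m}. X r = Y}. w r * val X \<sigma> y r) =
        (\<Sum>r\<in>{r\<in>{..<m}. X r = Y}. (w r * \<sigma> r) * (\<Prod>p\<in>Y. y p))"
      by (intro sum.cong) (auto simp: val_def)
    also have "\<dots> = (\<Sum>r\<in>{r\<in>{..<m}. X r = Y}. w r * \<sigma> r) * (\<Prod>p\<in>Y. y p)"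
      by (simp add: sum_distrib_right)
    also have "(\<Sum>r\<in>{r\<in>{..<m}. X r = Y}. w r * \<sigma> r) = coef X \<sigma> Y"
      unfolding coef_def by (rule sum.inter_filter) simp
    finally show "(\<Sum>r\<in>{r\<in>{..<m}. X r = Y}. w r * val X \<sigma> y r) = coef X \<sigma> Y * (\<Prod>p\<in>Y. y p)" .
  qed simp
  finally show ?thesis .
qed

lemma coef_nonzero: "coef X \<sigma> Y \<noteq> 0 \<Longrightarrow> \<exists>r<m. X r = Y"
  unfolding coef_def by (rule ccontr) (auto intro!: sum.neutral)

lemma coef_toggle: "coef (\<lambda>r. toggle Z p (X r)) \<sigma> (toggle Z p Y) = coef X \<sigma> Y"
  unfolding coef_def by (simp add: inj_eq[OF inj_toggle])

lemma val_toggle: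
  assumes "bounded_rows X" "j < m + n" "r < m + n" "p \<in> X j" "signs y"
  shows "val (\<lambda>r. toggle (X j) p (X r)) \<sigma> (y(p := \<Prod>i\<in>X j. y i)) r = val X \<sigma> y r"
  unfolding val_def using assms by (subst prod_toggle) (auto intro: finite_row)

text \<open>The substitution is its own inverse on sign vectors, so old and new variables realize
  the same row values, those of the variable rows included.\<close>

lemma reach_toggle:
  assumes "bounded_rows X" "j < m + n" "p \<in> X j"
  shows "reach (\<lambda>r. toggle (X j) p (X r)) \<sigma> z \<longleftrightarrow> reach X \<sigma> z"
proof
  assume "reach X \<sigma> z"
  then obtain y where y: "signs y" "\<forall>r<m+n. z r = val X \<sigma> y r" by (auto simp: reach_def)
  then show "reach (\<lambda>r. toggle (X j) p (X r)) \<sigma> z" unfolding reach_def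
    using y(2) val_toggle[OF assms(1,2) _ assms(3) y(1)] signs_upd[OF y(1) prod_signs[OF y(1)]]
    by (intro exI[of _ "y(p := \<Prod>i\<in>X j. y i)"]) auto
next
  assume "reach (\<lambda>r. toggle (X j) p (X r)) \<sigma> z"
  then obtain u where u: "signs u" "\<forall>r<m+n. z r = val (\<lambda>r. toggle (X j) p (X r)) \<sigma> u r"
    by (auto simp: reach_def)
  define y where "y = u(p := \<Prod>i\<in>X j. u i)"
  have y: "signs y" unfolding y_def using u(1) prod_signs[OF u(1)] by (intro signs_upd) auto
  have fin: "finite (X j)" using assms finite_row by auto
  have "(\<Prod>i\<in>X j. y i) = y p * (\<Prod>i\<in>X j - {p}. y i)"
    using fin assms(3) by (simp add: prod.remove)
  also have "(\<Prod>i\<in>X j - {p}. y i) = (\<Prod>i\<in>X j - {p}. u i)"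
    by (intro prod.cong) (auto simp: y_def)
  also have "y p = u p * (\<Prod>i\<in>X j - {p}. u i)"
    using fin assms(3) by (simp add: y_def prod.remove)
  finally have "(\<Prod>i\<in>X j. y i) = u p"
    using prod_signs_sq[OF u(1), of "X j - {p}"] by (simp add: mult.assoc)
  then have "y(p := \<Prod>i\<in>X j. y i) = u" by (auto simp: y_def)
  then show "reach X \<sigma> z" unfolding reach_def
    using y u val_toggle[OF assms(1,2) _ assms(3) y, of _ \<sigma>] by (intro exI[of _ y]) simp
qed

text \<open>A pivot step sends the class of row \<open>j\<close> to \<open>{p}\<close> and fixes all
  other singletons, while injectivity of \<open>toggle\<close> preserves combined weights; hence the
  stored signs stay correct. Processed rows of nonzero combined weight contain only pivots, so they
  avoid the new column and are not disturbed. In the end each class of nonzero weight is a product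
  of pivot variables.\<close>

lemma elim_invariant:
  assumes "bounded_rows X" "j \<le> m" "elim X \<sigma> j = (X', g)"
  shows "bounded_rows X' \<and> live X' \<subseteq> live X \<and> (\<forall>z. reach X' \<sigma> z \<longleftrightarrow> reach X \<sigma> z) \<and>
    coef X' \<sigma> {} = coef X \<sigma> {} \<and>
    (\<forall>p. g p \<noteq> 0 \<longrightarrow> p < n \<and> g p = sgn (coef X' \<sigma> {p})) \<and>
    (\<forall>i<j. coef X' \<sigma> (X' i) \<noteq> 0 \<longrightarrow> X' i \<subseteq> {p. g p \<noteq> 0})"
  using assms(2,3)
proof (induction j arbitrary: X' g)
  case 0
  then show ?case using assms(1) by auto
next
  case (Suc j)
  obtain X1 g1 where e: "elim X \<sigma> j = (X1, g1)" by fastforce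
  let ?p = "column X1 g1 j" and ?c = "coef X1 \<sigma> (X1 j)"
  have IH: "bounded_rows X1" "live X1 \<subseteq> live X" "\<And>z. reach X1 \<sigma> z \<longleftrightarrow> reach X \<sigma> z"
    "coef X1 \<sigma> {} = coef X \<sigma> {}"
    "\<And>p. g1 p \<noteq> 0 \<Longrightarrow> p < n \<and> g1 p = sgn (coef X1 \<sigma> {p})"
    "\<And>i. i < j \<Longrightarrow> coef X1 \<sigma> (X1 i) \<noteq> 0 \<Longrightarrow> X1 i \<subseteq> {p. g1 p \<noteq> 0}"
    using Suc.IH[OF _ e] Suc.prems(1) by auto
  have jm: "j < m + n" "j < m" using Suc.prems by auto
  note col = latest_cases[of "\<lambda>i. i \<in> X1 j \<and> g1 i = 0" n n, folded column_def]
  show ?case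
  proof (cases "?p < n \<and> ?c \<noteq> 0")
    case False
    then have eq: "X' = X1" "g = g1" using Suc.prems(2) e by (auto simp: Let_def)
    have "X1 j \<subseteq> {p. g1 p \<noteq> 0}" if "?c \<noteq> 0"
    proof -
      \<comment> \<open>No free column was found, so all variables of row \<open>j\<close> are
        pivots already.\<close>
      have "?p = n" "\<forall>i<n. \<not> (i \<in> X1 j \<and> g1 i = 0)" using False that col by auto
      moreover have "X1 j \<subseteq> {..<n}" using IH(1) jm by (auto simp: bounded_rows_def)
      ultimately show ?thesis by auto
    qed
    then show ?thesis using IH unfolding eq by (auto simp: less_Suc_eq)
  next
    case True
    let ?T = "toggle (X1 j) ?p"
    have eq: "X' = (\<lambda>r. ?T (X1 r))" "g = g1(?p := sgn ?c)"
      using Suc.prems(2) e True by (auto simp: Let_def)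
    have p: "?p \<in> X1 j" "g1 ?p = 0" using True col by auto
    have sub: "?T Y \<subseteq> Y \<union> X1 j" for Y by (auto simp: toggle_def)
    have "bounded_rows X'" unfolding bounded_rows_def eq
    proof (intro allI impI)
      fix r assume "r < m + n"
      then have "X1 r \<subseteq> {..<n}" "X1 j \<subseteq> {..<n}" using IH(1) jm by (auto simp: bounded_rows_def)
      with sub[of "X1 r"] show "?T (X1 r) \<subseteq> {..<n}" by blast
    qed
    moreover have "live X' \<subseteq> live X"
    proof
      fix q assume "q \<in> live X'"
      then obtain r where r: "r < m + n" "q \<in> ?T (X1 r)" by (auto simp: live_def eq)
      then have "q \<in> X1 r \<or> q \<in> X1 j" using sub by blast
      then have "q \<in> live X1" using r(1) jm(1) unfolding live_def by blast
      then show "q \<in> live X" using IH(2) by blast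
    qed
    moreover have "reach X' \<sigma> z \<longleftrightarrow> reach X \<sigma> z" for z
      unfolding eq using reach_toggle[OF IH(1) jm(1) p(1)] IH(3) by simp
    moreover have cT: "coef X' \<sigma> (?T Y) = coef X1 \<sigma> Y" for Y
      unfolding eq by (rule coef_toggle)
    moreover have "coef X' \<sigma> {} = coef X \<sigma> {}"
      using cT[of "{}"] IH(4) by (simp add: toggle_simps)
    moreover have "q < n \<and> g q = sgn (coef X' \<sigma> {q})" if "g q \<noteq> 0" for q
    proof (cases "q = ?p")
      case True': True
      then show ?thesis using cT[of "X1 j"] p True by (simp add: toggle_simps eq)
    next
      case False
      then have "?T {q} = {q}" by (simp add: toggle_simps)
      then show ?thesis using cT[of "{q}"] IH(5)[of q] that False by (simp add: eq)
    qed
    moreover have "X' i \<subseteq> {p. g p \<noteq> 0}" if "i < Suc j" "coef X' \<sigma> (X' i) \<noteq> 0" for i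
    proof (cases "i = j")
      case True': True
      then have "X' i = {?p}" using p by (simp add: eq toggle_simps)
      then show ?thesis using True by (auto simp: eq sgn_0_0)
    next
      case False
      have "coef X1 \<sigma> (X1 i) \<noteq> 0" using that(2) cT[of "X1 i"] by (simp add: eq)
      then have sub: "X1 i \<subseteq> {p. g1 p \<noteq> 0}" using IH(6)[of i] False that(1) by simp
      then have p': "?p \<notin> X1 i" using p by auto
      then have "X' i = X1 i" by (simp add: eq toggle_simps)
      then show ?thesis using sub p' by (auto simp: eq)
    qed
    ultimately show ?thesis by blast
  qed
qed

lemmas elim_props = elim_invariant[OF _ order_refl]

text \<open>On pivots this falsifies every combined equation \<open>{p}\<close>; the value 1
  elsewhere is arbitrary, as the other variables do not affect the excess.\<close>

definition opposite :: "(nat \<Rightarrow> int) \<Rightarrow> nat \<Rightarrow> int" where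
  "opposite g p = (if g p = 0 then 1 else - g p)"

definition candidate :: "(nat \<Rightarrow> nat set) \<Rightarrow> (nat \<Rightarrow> int) \<Rightarrow> nat \<Rightarrow> int" where
  "candidate X \<sigma> = (case elim X \<sigma> m of (X', g) \<Rightarrow> val X' \<sigma> (opposite g))"

text \<open>The branching digits are used up after \<open>D\<close> phases; from then on any pivot will do.\<close>

definition choice :: "nat \<Rightarrow> (nat \<Rightarrow> nat) \<Rightarrow> nat \<Rightarrow> (nat \<Rightarrow> int) \<Rightarrow> nat" where
  "choice D d t g = (if t < D then d t else latest (\<lambda>i. g i \<noteq> 0) n n)"

text \<open>If the chosen column is no pivot, only the elimination is kept, so that every digit
  sequence defines a run.\<close>

definition advance :: "nat \<Rightarrow> (nat \<Rightarrow> nat) \<Rightarrow> nat \<Rightarrow>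
    (nat \<Rightarrow> nat set) \<times> (nat \<Rightarrow> int) \<Rightarrow> (nat \<Rightarrow> nat set) \<times> (nat \<Rightarrow> int)" where
  "advance D d t = (\<lambda>(X, \<sigma>). case elim X \<sigma> m of (X', g) \<Rightarrow>
     let q = choice D d t g in
     if g q \<noteq> 0 then (fix_rows q X', fix_signs q (g q) X' \<sigma>) else (X', \<sigma>))"

lemma elim_signs:
  assumes "bounded_rows X" "elim X \<sigma> m = (X', g)"
  shows "g p \<in> {-1, 0, 1}"
proof (cases "g p = 0")
  case False
  then have "g p = sgn (coef X' \<sigma> {p})" using elim_props[OF assms] by blast
  then show ?thesis by (simp add: sgn_if)
qed simp

lemma signs_opposite:
  assumes "bounded_rows X" "elim X \<sigma> m = (X', g)"
  shows "signs (opposite g)"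
  using elim_signs[OF assms] unfolding signs_def opposite_def by fastforce

lemma reach_candidate:
  assumes "bounded_rows X"
  shows "reach X \<sigma> (candidate X \<sigma>)"
proof -
  obtain X' g where e: "elim X \<sigma> m = (X', g)" by fastforce
  have "reach X' \<sigma> (candidate X \<sigma>)" unfolding reach_def candidate_def e
    using signs_opposite[OF assms e] by auto
  then show ?thesis using elim_props[OF assms e] by simp
qed

text \<open>Classes of nonzero combined weight involve pivots only.\<close>

lemma total_cong:
  assumes "bounded_rows X" "elim X \<sigma> m = (X', g)" "\<And>p. g p \<noteq> 0 \<Longrightarrow> y p = y' p"
  shows "total (val X' \<sigma> y) = total (val X' \<sigma> y')"
  unfolding total_coef
proof (rule sum.cong)
  fix Y assume "Y \<in> X' ` {..<m}"
  then have "coef X' \<sigma> Y = 0 \<or> Y \<subseteq> {p. g p \<noteq> 0}" using elim_props[OF assms(1,2)] by auto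
  then show "coef X' \<sigma> Y * (\<Prod>p\<in>Y. y p) = coef X' \<sigma> Y * (\<Prod>p\<in>Y. y' p)"
    using assms(3) by (auto intro!: prod.cong)
qed simp

lemma total_reach_cong: "(\<And>r. r < m + n \<Longrightarrow> z r = z' r) \<Longrightarrow> total z = total z'"
  by (simp add: total_def)

text \<open>Without pivots every class of nonzero weight is empty, and the excess reduces to its
  constant term.\<close>

lemma exhausted_total:
  assumes "bounded_rows X" "elim X \<sigma> m = (X', g)" "\<And>p. g p = 0"
  shows "total (candidate X \<sigma>) = coef X \<sigma> {}"
proof -
  have "total (candidate X \<sigma>) = (\<Sum>Y\<in>X' ` {..<m}. coef X' \<sigma> Y * (\<Prod>p\<in>Y. opposite g p))"
    by (simp add: candidate_def assms(2) total_coef)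
  also have "\<dots> = (\<Sum>Y\<in>X' ` {..<m} \<inter> {{}}. coef X' \<sigma> Y)"
  proof (rule sum.mono_neutral_cong_right)
    show "\<forall>Y\<in>X' ` {..<m} - X' ` {..<m} \<inter> {{}}. coef X' \<sigma> Y * (\<Prod>p\<in>Y. opposite g p) = 0"
      using elim_props[OF assms(1,2)] assms(3) by fastforce
  qed auto
  also have "\<dots> = coef X' \<sigma> {}"
  proof (cases "{} \<in> X' ` {..<m}")
    case False
    then have "coef X' \<sigma> {} = 0" using coef_nonzero[of X' \<sigma> "{}"] by force
    then show ?thesis using False by simp
  next
    case True
    then have "X' ` {..<m} \<inter> {{}} = {{}}" by auto
    then show ?thesis by simp
  qed
  finally show ?thesis using elim_props[OF assms(1,2)] by simp
qed

text \<open>Deleting \<open>q\<close> sends exactly the classes \<open>{}\<close> and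
  \<open>{q}\<close> to \<open>{}\<close>, the latter with the factor \<open>v\<close>.\<close>

lemma coef_fix:
  "coef (fix_rows q X) (fix_signs q v X \<sigma>) {} = coef X \<sigma> {} + v * coef X \<sigma> {q}"
  unfolding coef_def sum_distrib_left sum.distrib[symmetric]
  by (intro sum.cong) (auto simp: fix_rows_def fix_signs_def)

lemma val_fix:
  assumes "finite (X r)"
  shows "val (fix_rows q X) (fix_signs q v X \<sigma>) y r = val X \<sigma> (y(q := v)) r"
proof (cases "q \<in> X r")
  case True
  have "(\<Prod>p\<in>X r - {q}. (y(q := v)) p) = (\<Prod>p\<in>X r - {q}. y p)" by (intro prod.cong) auto
  then show ?thesis using assms True
    by (simp add: val_def fix_rows_def fix_signs_def prod.remove[of "X r" q])
next
  case False
  then have "(\<Prod>p\<in>X r. (y(q := v)) p) = (\<Prod>p\<in>X r. y p)" by (intro prod.cong) auto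
  then show ?thesis using False by (simp add: val_def fix_rows_def fix_signs_def)
qed

lemma fix_sound:
  assumes "bounded_rows X" "v = 1 \<or> v = -1" "reach (fix_rows q X) (fix_signs q v X \<sigma>) z"
  shows "reach X \<sigma> z"
proof -
  obtain y where y: "signs y" "\<forall>r<m+n. z r = val (fix_rows q X) (fix_signs q v X \<sigma>) y r"
    using assms(3) by (auto simp: reach_def)
  then show ?thesis unfolding reach_def using assms(1,2)
    by (intro exI[of _ "y(q := v)"]) (auto simp: signs_upd val_fix finite_row)
qed

lemma fix_complete:
  assumes "bounded_rows X" "signs y" "y q = v" "\<forall>r<m+n. z r = val X \<sigma> y r"
  shows "reach (fix_rows q X) (fix_signs q v X \<sigma>) z"
proof -
  have "y(q := v) = y" using assms(3) by auto
  then show ?thesis unfolding reach_def using assms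
    by (intro exI[of _ y]) (auto simp: val_fix finite_row)
qed

lemma pivot_live:
  assumes "bounded_rows X" "elim X \<sigma> m = (X', g)" "g q \<noteq> 0"
  shows "q \<in> live X' \<and> q \<in> live X"
proof -
  note E = elim_props[OF assms(1,2)]
  have "g q = sgn (coef X' \<sigma> {q})" using E assms(3) by blast
  then have "coef X' \<sigma> {q} \<noteq> 0" using assms(3) by auto
  then obtain r where "r < m" "X' r = {q}" using coef_nonzero by blast
  then have "q \<in> live X'" by (force simp: live_def)
  then show ?thesis using E by blast
qed

text \<open>Since \<open>g q\<close> is the sign of the combined weight of \<open>{q}\<close>, the
  constant term grows by the absolute value of a nonzero integer, thus by at least 1. This is the
  gain that the parameter counts.\<close>

lemma advance_cases:
  assumes X: "bounded_rows X" and a: "advance D d t (X, \<sigma>) = (X2, \<tau>)"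
    and e: "elim X \<sigma> m = (X', g)"
  shows "bounded_rows X2" "\<And>z. reach X2 \<tau> z \<Longrightarrow> reach X \<sigma> z"
    "live X2 \<subseteq> live X" "coef X2 \<tau> {} \<ge> coef X \<sigma> {}"
    "g (choice D d t g) \<noteq> 0 \<Longrightarrow>
      X2 = fix_rows (choice D d t g) X' \<and> \<tau> = fix_signs (choice D d t g) (g (choice D d t g)) X' \<sigma> \<and>
      coef X2 \<tau> {} \<ge> coef X \<sigma> {} + 1 \<and> card (live X2) < card (live X)"
proof -
  let ?q = "choice D d t g"
  note E = elim_props[OF X e]
  have fin: "finite (live X)" using finite_row[OF X] by (auto simp: live_def)
  have *: "bounded_rows X2 \<and> (\<forall>z. reach X2 \<tau> z \<longrightarrow> reach X \<sigma> z) \<and> live X2 \<subseteq> live X \<and>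
    coef X2 \<tau> {} \<ge> coef X \<sigma> {} \<and> (g ?q \<noteq> 0 \<longrightarrow>
      X2 = fix_rows ?q X' \<and> \<tau> = fix_signs ?q (g ?q) X' \<sigma> \<and>
      coef X2 \<tau> {} \<ge> coef X \<sigma> {} + 1 \<and> card (live X2) < card (live X))"
  proof (cases "g ?q = 0")
    case True
    then have "X2 = X'" "\<tau> = \<sigma>" using a e by (auto simp: advance_def Let_def)
    then show ?thesis using True E by auto
  next
    case False
    then have eq: "X2 = fix_rows ?q X'" "\<tau> = fix_signs ?q (g ?q) X' \<sigma>"
      using a e by (auto simp: advance_def Let_def)
    have g: "g ?q = sgn (coef X' \<sigma> {?q})" using E False by blast
    then have c: "coef X' \<sigma> {?q} \<noteq> 0" using False by auto
    have "g ?q * coef X' \<sigma> {?q} = \<bar>coef X' \<sigma> {?q}\<bar>"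
      unfolding g by (simp add: sgn_if)
    then have "coef X2 \<tau> {} \<ge> coef X \<sigma> {} + 1"
      using c E unfolding eq coef_fix by auto
    moreover have "live X2 \<subset> live X"
    proof -
      have "?q \<in> live X'" using pivot_live[OF X e False] by simp
      moreover have "live X2 \<subseteq> live X' - {?q}" by (auto simp: live_def eq fix_rows_def)
      ultimately show ?thesis using E by blast
    qed
    moreover from this have "card (live X2) < card (live X)" by (intro psubset_card_mono fin)
    moreover have "bounded_rows X2" using E by (auto simp: bounded_rows_def eq fix_rows_def)
    moreover have "reach X \<sigma> z" if "reach X2 \<tau> z" for z
      using fix_sound[of X' "g ?q" ?q \<sigma> z] that E elim_signs[OF X e, of ?q] False
      unfolding eq by auto
    ultimately show ?thesis using eq by auto
  qed
  show "bounded_rows X2" "\<And>z. reach X2 \<tau> z \<Longrightarrow> reach X \<sigma> z"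
    "live X2 \<subseteq> live X" "coef X2 \<tau> {} \<ge> coef X \<sigma> {}"
    "g ?q \<noteq> 0 \<Longrightarrow>
      X2 = fix_rows ?q X' \<and> \<tau> = fix_signs ?q (g ?q) X' \<sigma> \<and>
      coef X2 \<tau> {} \<ge> coef X \<sigma> {} + 1 \<and> card (live X2) < card (live X)"
    using * by blast+
qed

text \<open>Agreeing with \<open>opposite g\<close> on all pivots would give exactly the excess of
  the candidate. An assignment that does strictly better must satisfy some pivot, and it survives
  the corresponding substitution.\<close>

lemma satisfied_pivot:
  assumes X: "bounded_rows X" and e: "elim X \<sigma> m = (X', g)"
    and z: "reach X \<sigma> z" and lt: "total (candidate X \<sigma>) < total z"
  obtains q where "g q \<noteq> 0" "q < n" "reach (fix_rows q X') (fix_signs q (g q) X' \<sigma>) z"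
proof -
  note E = elim_props[OF X e]
  obtain y where y: "signs y" "\<forall>r<m+n. z r = val X' \<sigma> y r"
  proof -
    have "reach X' \<sigma> z" using z E by blast
    then show ?thesis using that by (auto simp: reach_def)
  qed
  have "total z = total (val X' \<sigma> y)" using y by (intro total_reach_cong) auto
  then have "\<not> (\<forall>p. g p \<noteq> 0 \<longrightarrow> y p = opposite g p)"
    using total_cong[OF X e, of y "opposite g"] lt by (auto simp: candidate_def e)
  then obtain q where q: "g q \<noteq> 0" "y q \<noteq> opposite g q" by blast
  then have "y q = g q"
    using elim_signs[OF X e, of q] y(1) by (auto simp: opposite_def signs_def)
  then have "reach (fix_rows q X') (fix_signs q (g q) X' \<sigma>) z"
    using fix_complete[of X' y q "g q" z \<sigma>] E y by auto
  then show ?thesis using that[of q] q E by blast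
qed

end

section \<open>Following a good assignment through the branching\<close>

locale branching = elimination +
  fixes X0 :: "nat \<Rightarrow> nat set" and \<sigma>0 :: "nat \<Rightarrow> int" and D :: nat
  assumes bounded0: "bounded_rows X0"
begin

primrec state :: "(nat \<Rightarrow> nat) \<Rightarrow> nat \<Rightarrow> (nat \<Rightarrow> nat set) \<times> (nat \<Rightarrow> int)" where
  "state d 0 = (X0, \<sigma>0)"
| "state d (Suc t) = advance D d t (state d t)"

definition outcome :: "(nat \<Rightarrow> nat) \<Rightarrow> nat \<Rightarrow> nat \<Rightarrow> int" where
  "outcome d t = (case state d t of (X, \<sigma>) \<Rightarrow> candidate X \<sigma>)"

text \<open>Digits at times from \<open>t\<close> on, or beyond the first \<open>D\<close>, are not
  consulted. This permits extending a sequence digit by digit and replacing it by the digits of a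
  counter.\<close>

lemma state_cong:
  "(\<And>i. i < t \<Longrightarrow> i < D \<Longrightarrow> d i = d' i) \<Longrightarrow> state d t = state d' t"
  by (induction t) (auto simp: advance_def choice_def split: prod.splits)

lemma state_sound:
  "state d t = (X, \<sigma>) \<Longrightarrow> bounded_rows X \<and> (\<forall>z. reach X \<sigma> z \<longrightarrow> reach X0 \<sigma>0 z)"
proof (induction t arbitrary: X \<sigma>)
  case 0
  then show ?case using bounded0 by simp
next
  case (Suc t)
  obtain X1 \<sigma>1 where s: "state d t = (X1, \<sigma>1)" by fastforce
  obtain X' g where e: "elim X1 \<sigma>1 m = (X', g)" by fastforce
  have "advance D d t (X1, \<sigma>1) = (X, \<sigma>)" using Suc.prems s by simp
  from advance_cases(1,2)[OF _ this e] Suc.IH[OF s] show ?case by blast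
qed

lemma outcome_sound: "reach X0 \<sigma>0 (outcome d t)"
proof -
  obtain X \<sigma> where s: "state d t = (X, \<sigma>)" by fastforce
  then show ?thesis using state_sound[OF s] reach_candidate[of X \<sigma>] by (simp add: outcome_def)
qed

text \<open>The digits are read off from \<open>z\<close>: as long as no test succeeds,
  \<open>z\<close> beats the candidate, and the next digit is a pivot that \<open>z\<close>
  satisfies. The bound on \<open>card (live X) + t\<close> records that each choice uses up a
  variable. The guard \<open>0 < n\<close> makes the dummy digit 0 legal while \<open>D\<close> is
  not yet tied to \<open>n\<close>.\<close>

lemma follow:
  assumes z: "reach X0 \<sigma>0 z" "K \<le> total z" and c0: "coef X0 \<sigma>0 {} \<ge> 0"
  shows "t \<le> D \<Longrightarrow> \<exists>d. (\<forall>i<t. 0 < n \<longrightarrow> d i < n) \<and> ((\<exists>u<t. K \<le> total (outcome d u)) \<or>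
    (\<exists>X \<sigma>. state d t = (X, \<sigma>) \<and> reach X \<sigma> z \<and> coef X \<sigma> {} \<ge> int t \<and> card (live X) + t \<le> n))"
proof (induction t)
  case 0
  have "live X0 \<subseteq> {..<n}" using bounded0 by (auto simp: live_def bounded_rows_def)
  then have "card (live X0) \<le> n" by (metis card_lessThan card_mono finite_lessThan)
  then show ?case using z c0 by auto
next
  case (Suc t)
  then obtain d where d: "\<forall>i<t. 0 < n \<longrightarrow> d i < n" and
    dis: "(\<exists>u<t. K \<le> total (outcome d u)) \<or>
      (\<exists>X \<sigma>. state d t = (X, \<sigma>) \<and> reach X \<sigma> z \<and> coef X \<sigma> {} \<ge> int t \<and> card (live X) + t \<le> n)"
    by auto
  show ?case
  proof (cases "\<exists>u<Suc t. K \<le> total (outcome d u)")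
    case True
    then obtain u where u: "u < Suc t" "K \<le> total (outcome d u)" by blast
    \<comment> \<open>A test has already succeeded, so the new digit is a dummy that leaves the
      earlier stages unchanged.\<close>
    have "state (d(t := 0)) u = state d u" using u by (intro state_cong) auto
    then have "outcome (d(t := 0)) u = outcome d u" by (simp add: outcome_def)
    then have "K \<le> total (outcome (d(t := 0)) u)" using u by simp
    then have "\<exists>u<Suc t. K \<le> total (outcome (d(t := 0)) u)" using u(1) by blast
    moreover have "\<forall>i<Suc t. 0 < n \<longrightarrow> (d(t := 0)) i < n" using d by (simp add: less_Suc_eq)
    ultimately show ?thesis by blast
  next
    case False
    then obtain X \<sigma> where s: "state d t = (X, \<sigma>)" "reach X \<sigma> z" "coef X \<sigma> {} \<ge> int t"
      "card (live X) + t \<le> n" using dis less_Suc_eq by blast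
    have X: "bounded_rows X" using state_sound[OF s(1)] by simp
    obtain X' g where e: "elim X \<sigma> m = (X', g)" by fastforce
    have "total (candidate X \<sigma>) < total z"
      using False s(1) z(2) by (force simp: outcome_def)
    from satisfied_pivot[OF X e s(2) this] obtain q where
      q: "g q \<noteq> 0" "q < n" "reach (fix_rows q X') (fix_signs q (g q) X' \<sigma>) z" by blast
    let ?d = "d(t := q)"
    have st: "state ?d t = (X, \<sigma>)" using s(1) state_cong[of t ?d d] by simp
    have ch: "choice D ?d t g = q" using Suc.prems by (simp add: choice_def)
    obtain X2 \<tau> where a: "advance D ?d t (X, \<sigma>) = (X2, \<tau>)" by fastforce
    have "state ?d (Suc t) = (X2, \<tau>)" using st a by simp
    moreover have "\<forall>i<Suc t. 0 < n \<longrightarrow> ?d i < n" using d q by (auto simp: less_Suc_eq)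
    moreover have "reach X2 \<tau> z" "coef X2 \<tau> {} \<ge> int (Suc t)" "card (live X2) + Suc t \<le> n"
      using advance_cases(5)[OF X a e] q s(3,4) unfolding ch by auto
    ultimately show ?thesis by blast
  qed
qed

text \<open>Any pivot may now be substituted, since this never lowers the constant term. Each
  substitution uses up a variable, and once no pivot is left the candidate attains the constant
  term.\<close>

lemma finish:
  assumes "state d t = (X, \<sigma>)" "D \<le> t" "coef X \<sigma> {} \<ge> K"
  shows "\<exists>u \<le> t + card (live X). K \<le> total (outcome d u)"
  using assms
proof (induction "card (live X)" arbitrary: t X \<sigma> rule: less_induct)
  case less
  have X: "bounded_rows X" using state_sound[OF less.prems(1)] by simp
  obtain X' g where e: "elim X \<sigma> m = (X', g)" by fastforce
  let ?q = "choice D d t g"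
  have q: "?q = latest (\<lambda>i. g i \<noteq> 0) n n" using less.prems by (simp add: choice_def)
  show ?case
  proof (cases "g ?q = 0")
    case True
    then have "\<forall>p<n. g p = 0" using latest_cases[of "\<lambda>i. g i \<noteq> 0" n n] unfolding q by auto
    then have "g p = 0" for p using elim_props[OF X e] by blast
    then have "K \<le> total (outcome d t)"
      using exhausted_total[OF X e] less.prems by (simp add: outcome_def)
    then show ?thesis by (intro exI[of _ t]) simp
  next
    case False
    obtain X2 \<tau> where a: "advance D d t (X, \<sigma>) = (X2, \<tau>)" by fastforce
    note A = advance_cases(5)[OF X a e False]
    have "\<exists>u \<le> Suc t + card (live X2). K \<le> total (outcome d u)"
      using less.prems a A by (intro less.hyps) auto
    then obtain u where u: "u \<le> Suc t + card (live X2)" "K \<le> total (outcome d u)" by blast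
    then have "u \<le> t + card (live X)" using A by linarith
    then show ?thesis using u by blast
  qed
qed

text \<open>After \<open>D\<close> branching phases at most \<open>n\<close> variables remain, so at
  most \<open>n\<close> further phases follow before the last test; hence the
  \<open>D + n + 1\<close> phases of the program.\<close>

lemma complete:
  assumes z: "reach X0 \<sigma>0 z" "int (2 * k) \<le> total z" and c0: "coef X0 \<sigma>0 {} \<ge> 0"
    and D: "D = min (2 * k) n"
  shows "\<exists>d. (\<forall>i<D. d i < n) \<and> (\<exists>u \<le> D + n. int (2 * k) \<le> total (outcome d u))"
proof -
  obtain d where d: "\<forall>i<D. 0 < n \<longrightarrow> d i < n" and
    dis: "(\<exists>u<D. int (2 * k) \<le> total (outcome d u)) \<or>
      (\<exists>X \<sigma>. state d D = (X, \<sigma>) \<and> reach X \<sigma> z \<and> coef X \<sigma> {} \<ge> int D \<and> card (live X) + D \<le> n)"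
    using follow[OF z c0 order_refl] by auto
  have "\<exists>u \<le> D + n. int (2 * k) \<le> total (outcome d u)"
  proof (cases "\<exists>u<D. int (2 * k) \<le> total (outcome d u)")
    case True
    then show ?thesis by (meson less_imp_le_nat trans_le_add1)
  next
    case False
    then obtain X \<sigma> where s: "state d D = (X, \<sigma>)" "reach X \<sigma> z" "coef X \<sigma> {} \<ge> int D"
      "card (live X) + D \<le> n" using dis by blast
    have X: "bounded_rows X" using state_sound[OF s(1)] by simp
    show ?thesis
    proof (cases "D = 2 * k")
      case True
      with finish[OF s(1) order_refl, of "int (2 * k)"] s(3) obtain u where
        u: "u \<le> D + card (live X)" "int (2 * k) \<le> total (outcome d u)" by auto
      then have "u \<le> D + n" using s(4) by linarith
      then show ?thesis using u by blast
    next
      case False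
      \<comment> \<open>Here \<open>D = n < 2 * k\<close>, so the choices have used up all
        variables; with no pivot left, \<open>z\<close> cannot beat the candidate.\<close>
      then have "card (live X) = 0" using s D by auto
      then have "live X = {}" using finite_row[OF X] by (simp add: live_def)
      moreover obtain X' g where e: "elim X \<sigma> m = (X', g)" by fastforce
      ultimately have "\<not> total (candidate X \<sigma>) < total z"
        using satisfied_pivot[OF X e s(2)] pivot_live[OF X e] by blast
      then show ?thesis using s z by (intro exI[of _ D]) (auto simp: outcome_def)
    qed
  qed
  moreover have "\<forall>i<D. d i < n" using d D by auto
  ultimately show ?thesis by blast
qed

end

subsection \<open>Weakest preconditions with time bounds\<close>

text \<open>
  A bound on the running time under the proviso that every loop is run through at most \<open>L\<close> times
  whenever it is reached.
\<close>

primrec tcost :: "nat \<Rightarrow> com \<Rightarrow> nat" where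
  "tcost L Skip = 1"
| "tcost L (Assign a e e') = 1 + acost e + acost e'"
| "tcost L (Seq c1 c2) = tcost L c1 + tcost L c2"
| "tcost L (Cond b c1 c2) = 1 + bcost b + tcost L c1 + tcost L c2"
| "tcost L (While b c) = (1 + bcost b) + L * (1 + bcost b + tcost L c)"

text \<open>Polynomially bounded functions of \<open>L\<close> contain the constants and are closed
  under addition and under multiplication by \<open>L\<close>, which is all that
  \<open>tcost\<close> uses. The degree depends on the program alone.\<close>

lemma tcost_polynomial: "\<exists>C a. \<forall>L\<ge>1. tcost L c \<le> C * L ^ a"
proof -
  define poly where "poly f \<longleftrightarrow> (\<exists>C a. \<forall>L\<ge>1. f L \<le> C * L ^ a)" for f :: "nat \<Rightarrow> nat"
  have const: "poly (\<lambda>L. u)" for u unfolding poly_def by (rule exI[of _ u], rule exI[of _ 0]) simp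
  have add: "poly (\<lambda>L. f L + g L)" if fg: "poly f" "poly g" for f g
  proof -
    obtain C a E b where *: "\<forall>L\<ge>1. f L \<le> C * L ^ a" "\<forall>L\<ge>1. g L \<le> E * L ^ b"
      using fg unfolding poly_def by blast
    have "f L + g L \<le> (C + E) * L ^ (a + b)" if "L \<ge> 1" for L
    proof -
      have "L ^ a \<le> L ^ (a + b)" and "L ^ b \<le> L ^ (a + b)" using that by (simp_all add: power_increasing)
      then have "C * L ^ a \<le> C * L ^ (a + b)" "E * L ^ b \<le> E * L ^ (a + b)"
        by (auto intro: mult_le_mono2)
      then show ?thesis using *[rule_format, OF that] unfolding add_mult_distrib by linarith
    qed
    then show ?thesis unfolding poly_def by blast
  qed
  have mult: "poly (\<lambda>L. L * f L)" if f: "poly f" for f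
  proof -
    obtain C a where *: "\<forall>L\<ge>1. f L \<le> C * L ^ a" using f unfolding poly_def by blast
    have "L * f L \<le> C * L ^ Suc a" if "L \<ge> 1" for L
      using mult_le_mono2[OF *[rule_format, OF that], of L] by (simp add: mult_ac)
    then show ?thesis unfolding poly_def by blast
  qed
  have "poly (\<lambda>L. tcost L c)"
    by (induction c) (simp_all only: tcost.simps, (intro const add mult | assumption)+)
  then show ?thesis unfolding poly_def .
qed

definition wp :: "nat \<Rightarrow> com \<Rightarrow> store \<Rightarrow> (store \<Rightarrow> bool) \<Rightarrow> bool" where
  "wp L c s Q \<longleftrightarrow> (\<exists>t s'. exec c s t s' \<and> t \<le> tcost L c \<and> Q s')"

fun writes :: "com \<Rightarrow> vname set" where
  "writes Skip = {}"
| "writes (Assign a e e') = {a}"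
| "writes (Seq c1 c2) = writes c1 \<union> writes c2"
| "writes (Cond b c1 c2) = writes c1 \<union> writes c2"
| "writes (While b c) = writes c"

lemma exec_writes: "exec c s t s' \<Longrightarrow> a \<notin> writes c \<Longrightarrow> s' a = s a"
  by (induction rule: exec.induct) auto

text \<open>Besides weakening, this is the frame rule: arrays that a program does not write keep
  their contents, so specifications mention only what changes.\<close>

lemma wp_mono:
  assumes "wp L c s P" "\<And>s'. P s' \<Longrightarrow> (\<And>a. a \<notin> writes c \<Longrightarrow> s' a = s a) \<Longrightarrow> Q s'"
  shows "wp L c s Q"
  using assms exec_writes unfolding wp_def by meson

lemma wp_Skip: "Q s \<Longrightarrow> wp L Skip s Q"
  unfolding wp_def using exec.Skip by fastforce

lemma wp_Assign: "Q (s(a := (s a)(aval e s := aval e' s))) \<Longrightarrow> wp L (Assign a e e') s Q"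
  unfolding wp_def using exec.Assign by fastforce

lemma wp_Seq: "wp L c1 s (\<lambda>s'. wp L c2 s' Q) \<Longrightarrow> wp L (Seq c1 c2) s Q"
  unfolding wp_def by (metis add_mono exec.Seq tcost.simps(3))

lemma wp_Cond:
  assumes "bval b s \<Longrightarrow> wp L c1 s Q" "\<not> bval b s \<Longrightarrow> wp L c2 s Q"
  shows "wp L (Cond b c1 c2) s Q"
proof (cases "bval b s")
  case True
  then obtain t s' where "exec c1 s t s'" "t \<le> tcost L c1" "Q s'" using assms by (auto simp: wp_def)
  with exec.CondTrue[OF True this(1), of c2] show ?thesis unfolding wp_def by fastforce
next
  case False
  then obtain t s' where "exec c2 s t s'" "t \<le> tcost L c2" "Q s'" using assms by (auto simp: wp_def)
  with exec.CondFalse[OF False this(1), of c1] show ?thesis unfolding wp_def by fastforce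
qed

text \<open>The number \<open>M\<close> of rounds is explicit instead of bounded by
  \<open>L\<close>, because the outermost loop runs \<open>n ^ D\<close> times.\<close>

lemma exec_While:
  assumes "\<And>j s. j < (M::nat) \<Longrightarrow> Inv j s \<Longrightarrow>
      bval b s \<and> (\<exists>t s'. exec c s t s' \<and> t \<le> T \<and> Inv (Suc j) s')"
    and "\<And>s. Inv M s \<Longrightarrow> \<not> bval b s" and "Inv 0 s"
  shows "\<exists>t s'. exec (While b c) s t s' \<and> t \<le> 1 + bcost b + M * (1 + bcost b + T) \<and> Inv M s'"
proof -
  have "\<exists>t s'. exec (While b c) s t s' \<and> t \<le> 1 + bcost b + i * (1 + bcost b + T) \<and> Inv M s'"
    if "i \<le> M" "Inv (M - i) s" for i s
    using that
  proof (induction i arbitrary: s)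
    case 0
    then show ?case using exec.WhileFalse[of b s c] assms(2) by fastforce
  next
    case (Suc i)
    from assms(1)[OF _ Suc.prems(2)] Suc.prems(1) obtain t s' where
      1: "bval b s" "exec c s t s'" "t \<le> T" "Inv (Suc (M - Suc i)) s'" by auto
    from Suc.prems(1) have "Suc (M - Suc i) = M - i" by simp
    with 1(4) Suc.IH[of s'] Suc.prems(1) obtain u s'' where
      2: "exec (While b c) s' u s''" "u \<le> 1 + bcost b + i * (1 + bcost b + T)" "Inv M s''" by auto
    have "1 + bcost b + t + u \<le> 1 + bcost b + Suc i * (1 + bcost b + T)" using 1(3) 2(2) by simp
    then show ?case using exec.WhileTrue[OF 1(1,2) 2(1)] 2(3) by blast
  qed
  from this[of M s] assms(3) show ?thesis by simp
qed

definition For :: "vname \<Rightarrow> vname \<Rightarrow> com \<Rightarrow> com" where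
  "For i u c = Seq (Assign i (N 0) (N 0))
     (While (Less (Var i) (Var u)) (Seq c (Assign i (N 0) (Plus (Var i) (N 1)))))"

lemma writes_For [simp]: "writes (For i u c) = insert i (writes c)"
  by (auto simp: For_def)

text \<open>The counter and the frame are tracked by the rule itself, so \<open>Inv\<close> must not
  depend on the counter (\<open>indep\<close>). In the uses below, cases 1 to 9 are the premises in
  order: \<open>step\<close>, \<open>final\<close>, the two parts of \<open>u\<close>, the three of
  \<open>names\<close>, \<open>indep\<close>, \<open>init\<close>.\<close>

lemma wp_For:
  assumes step: "\<And>j s'. j < M \<Longrightarrow> Inv j s' \<Longrightarrow> s' i 0 = int j \<Longrightarrow>
      (\<And>a. a \<notin> insert i (writes c) \<Longrightarrow> s' a = s a) \<Longrightarrow> wp L c s' (Inv (Suc j))"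
    and final: "\<And>s'. Inv M s' \<Longrightarrow> (\<And>a. a \<notin> insert i (writes c) \<Longrightarrow> s' a = s a) \<Longrightarrow> Q s'"
    and u: "s u 0 = int M" "M \<le> L" and names: "i \<noteq> u" "u \<notin> writes c" "i \<notin> writes c"
    and indep: "\<And>j s v. Inv j s \<Longrightarrow> Inv j (s(i := v))"
    and init: "Inv 0 s"
  shows "wp L (For i u c) s Q"
proof -
  let ?I = "\<lambda>j s'. Inv j s' \<and> s' i 0 = int j \<and> (\<forall>a. a \<notin> insert i (writes c) \<longrightarrow> s' a = s a)"
  let ?b = "Less (Var i) (Var u)" and ?c = "Seq c (Assign i (N 0) (Plus (Var i) (N 1)))"
  let ?s = "s(i := (s i)(0 := 0))"
  have bound: "s' u 0 = int M" if "\<forall>a. a \<notin> insert i (writes c) \<longrightarrow> s' a = s a" for s' :: store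
    using that u(1) names by auto
  have "\<exists>t s'. exec (While ?b ?c) ?s t s' \<and> t \<le> 1 + bcost ?b + M * (1 + bcost ?b + tcost L ?c) \<and> ?I M s'"
  proof (rule exec_While)
    fix j s' assume j: "j < M" "?I j s'"
    have "wp L ?c s' (?I (Suc j))"
      by (rule wp_Seq, rule wp_mono[OF step], use j names in \<open>auto intro!: wp_Assign indep\<close>)
    then show "bval ?b s' \<and> (\<exists>t s''. exec ?c s' t s'' \<and> t \<le> tcost L ?c \<and> ?I (Suc j) s'')"
      using j bound[of s'] by (auto simp: wp_def)
  next
    fix s' assume "?I M s'"
    then show "\<not> bval ?b s'" using bound[of s'] by auto
  next
    show "?I 0 ?s" using init indep by auto
  qed
  then obtain t s' where w: "exec (While ?b ?c) ?s t s'"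
    "t \<le> 1 + bcost ?b + M * (1 + bcost ?b + tcost L ?c)" "?I M s'" by blast
  have "exec (For i u c) s (3 + t) s'"
    using exec.Seq[OF exec.Assign[of i "N 0" "N 0" s], of _ t s'] w(1)
    by (simp add: For_def eval_nat_numeral)
  moreover have "M * (1 + bcost ?b + tcost L ?c) \<le> L * (1 + bcost ?b + tcost L ?c)"
    using u(2) by (rule mult_le_mono1)
  then have "3 + t \<le> tcost L (For i u c)" using w(2) unfolding For_def by simp
  moreover have "Q s'" using w(3) final by blast
  ultimately show ?thesis unfolding wp_def by blast
qed

subsection \<open>The program\<close>

abbreviation Eq :: "aexp \<Rightarrow> aexp \<Rightarrow> bexp" where
  "Eq a b \<equiv> BAnd (BNot (Less a b)) (BNot (Less b a))"

text \<open>The machine cannot multiply, so the row offsets \<open>off[r] = r * n\<close> are tabulated by addition.\<close>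

abbreviation Entry :: "aexp \<Rightarrow> aexp \<Rightarrow> aexp" where
  "Entry r p \<equiv> Cell ''M'' (Plus (Cell ''off'' r) p)"

definition find_column :: com where
  "find_column = Seq (Assign ''p'' (N 0) (Var ''n''))
     (For ''i'' ''n''
       (Cond (BAnd (Less (N 0) (Entry (Var ''j'') (Var ''i''))) (Eq (Cell ''g'' (Var ''i'')) (N 0)))
         (Assign ''p'' (N 0) (Var ''i'')) Skip))"

definition class_coef :: com where
  "class_coef = Seq (Assign ''cf'' (N 0) (N 0))
     (For ''r'' ''m''
       (Seq (Assign ''eq'' (N 0) (N 1))
       (Seq (For ''i'' ''n''
              (Cond (Eq (Entry (Var ''r'') (Var ''i'')) (Entry (Var ''j'') (Var ''i'')))
                Skip (Assign ''eq'' (N 0) (N 0))))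
         (Cond (Less (N 0) (Var ''eq''))
           (Cond (Less (N 0) (Cell ''s'' (Var ''r'')))
             (Assign ''cf'' (N 0) (Plus (Var ''cf'') (Cell ''w'' (Var ''r''))))
             (Assign ''cf'' (N 0) (Minus (Var ''cf'') (Cell ''w'' (Var ''r'')))))
           Skip))))"

text \<open>Columns form the outer loop because row \<open>j\<close> contains \<open>p\<close> and
  is changed too: its entry \<open>i\<close> is tested before the inner loop alters it, and column
  \<open>p\<close>, which guards the updates, is never written.\<close>

definition toggle_rows :: com where
  "toggle_rows = For ''i'' ''n''
     (Cond (BAnd (Less (N 0) (Entry (Var ''j'') (Var ''i''))) (BNot (Eq (Var ''i'') (Var ''p''))))
       (For ''r'' ''rows''
         (Cond (Less (N 0) (Entry (Var ''r'') (Var ''p'')))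
           (Assign ''M'' (Plus (Cell ''off'' (Var ''r'')) (Var ''i''))
             (Minus (N 1) (Entry (Var ''r'') (Var ''i''))))
           Skip))
       Skip)"

definition eliminate :: com where
  "eliminate = Seq (For ''i'' ''n'' (Assign ''g'' (Var ''i'') (N 0)))
     (For ''j'' ''m''
       (Seq find_column
       (Seq class_coef
         (Cond (BAnd (Less (Var ''p'') (Var ''n'')) (BNot (Eq (Var ''cf'') (N 0))))
           (Seq toggle_rows
             (Cond (Less (N 0) (Var ''cf''))
               (Assign ''g'' (Var ''p'') (N 1))
               (Assign ''g'' (Var ''p'') (N (-1)))))
           Skip))))"

text \<open>\<open>opposite g\<close> is -1 exactly where \<open>g\<close> is positive.\<close>

definition evaluate :: com where
  "evaluate = For ''r'' ''rows''
     (Seq (Assign ''v'' (Var ''r'') (Cell ''s'' (Var ''r'')))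
       (For ''i'' ''n''
         (Cond (BAnd (Less (N 0) (Entry (Var ''r'') (Var ''i''))) (Less (N 0) (Cell ''g'' (Var ''i''))))
           (Assign ''v'' (Var ''r'') (Minus (N 0) (Cell ''v'' (Var ''r'')))) Skip)))"

text \<open>\<open>found\<close> is only ever raised; a later success may replace \<open>x\<close>
  by another good assignment.\<close>

definition test_candidate :: com where
  "test_candidate = Seq (Assign ''ex'' (N 0) (N 0))
     (Seq (For ''r'' ''m''
        (Cond (Less (N 0) (Cell ''v'' (Var ''r'')))
          (Assign ''ex'' (N 0) (Plus (Var ''ex'') (Cell ''w'' (Var ''r''))))
          (Assign ''ex'' (N 0) (Minus (Var ''ex'') (Cell ''w'' (Var ''r''))))))
       (Cond (Less (Var ''ex'') (Plus (Var ''k'') (Var ''k''))) Skip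
         (Seq (Assign ''found'' (N 0) (N 1))
           (For ''i'' ''n''
             (Assign ''x'' (Plus (Var ''i'') (N 1)) (Cell ''v'' (Plus (Var ''m'') (Var ''i''))))))))"

definition choose_column :: com where
  "choose_column = Cond (Less (Var ''t'') (Var ''D''))
     (Assign ''q'' (N 0) (Cell ''d'' (Var ''t'')))
     (Seq (Assign ''q'' (N 0) (Var ''n''))
       (For ''i'' ''n'' (Cond (Eq (Cell ''g'' (Var ''i'')) (N 0)) Skip
         (Assign ''q'' (N 0) (Var ''i'')))))"

text \<open>The test \<open>q < n\<close> rejects the default \<open>n\<close> of a scan that met no
  pivot.\<close>

definition fix_column :: com where
  "fix_column = Cond (BAnd (Less (Var ''q'') (Var ''n'')) (BNot (Eq (Cell ''g'' (Var ''q'')) (N 0))))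
     (For ''r'' ''rows''
       (Cond (Less (N 0) (Entry (Var ''r'') (Var ''q'')))
         (Seq (Assign ''M'' (Plus (Cell ''off'' (Var ''r'')) (Var ''q'')) (N 0))
           (Cond (Less (Cell ''g'' (Var ''q'')) (N 0))
             (Assign ''s'' (Var ''r'') (Minus (N 0) (Cell ''s'' (Var ''r'')))) Skip))
         Skip))
     Skip"

definition phase :: com where
  "phase = Seq eliminate (Seq evaluate (Seq test_candidate (Seq choose_column fix_column)))"

definition reset :: com where
  "reset = Seq
     (For ''r'' ''m''
       (Seq (Assign ''s'' (Var ''r'') (Cell ''b'' (Var ''r'')))
         (For ''i'' ''n'' (Assign ''M'' (Plus (Cell ''off'' (Var ''r'')) (Var ''i''))
           (Cell ''A'' (Plus (Cell ''off'' (Var ''r'')) (Var ''i'')))))))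
     (For ''p'' ''n''
       (Seq (Assign ''s'' (Plus (Var ''m'') (Var ''p'')) (N 1))
         (For ''i'' ''n''
           (Cond (Eq (Var ''i'') (Var ''p''))
             (Assign ''M'' (Plus (Cell ''off'' (Plus (Var ''m'') (Var ''p''))) (Var ''i'')) (N 1))
             (Assign ''M'' (Plus (Cell ''off'' (Plus (Var ''m'') (Var ''p''))) (Var ''i'')) (N 0))))))"

text \<open>A carry that survives all \<open>D\<close> digits means that every sequence has been
  tried. For \<open>D = 0\<close> it survives at once, so there is a single trial.\<close>

definition increment :: com where
  "increment = Seq (Assign ''carry'' (N 0) (N 1))
     (Seq (For ''i'' ''D''
        (Cond (Less (N 0) (Var ''carry''))
          (Cond (Less (Plus (Cell ''d'' (Var ''i'')) (N 1)) (Var ''n''))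
            (Seq (Assign ''d'' (Var ''i'') (Plus (Cell ''d'' (Var ''i'')) (N 1)))
              (Assign ''carry'' (N 0) (N 0)))
            (Assign ''d'' (Var ''i'') (N 0)))
          Skip))
       (Cond (Less (N 0) (Var ''carry'')) (Assign ''go'' (N 0) (N 0)) Skip))"

definition setup_arrays :: com where
  "setup_arrays = Seq (Assign ''rows'' (N 0) (Plus (Var ''m'') (Var ''n'')))
     (Seq (Assign ''D'' (N 0) (Plus (Var ''k'') (Var ''k'')))
     (Seq (Cond (Less (Var ''n'') (Var ''D'')) (Assign ''D'' (N 0) (Var ''n'')) Skip)
     (Seq (Assign ''T'' (N 0) (Plus (Plus (Var ''D'') (Var ''n'')) (N 1)))
     (Seq (Assign ''go'' (N 0) (N 1))
     (Seq (Assign ''o'' (N 0) (N 0))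
       (For ''r'' ''rows''
         (Seq (Assign ''off'' (Var ''r'') (Var ''o''))
           (Assign ''o'' (N 0) (Plus (Var ''o'') (Var ''n''))))))))))"

definition try_choices :: com where
  "try_choices = Seq reset (Seq (For ''t'' ''T'' phase) increment)"

definition search_program :: com where
  "search_program = Seq setup_arrays (While (Less (N 0) (Var ''go'')) try_choices)"

lemma index_eq:
  assumes "p < n" "p' < (n::nat)"
  shows "int r * int n + int p = int r' * int n + int p' \<longleftrightarrow> r = r' \<and> p = p'"
proof
  assume "int r * int n + int p = int r' * int n + int p'"
  then have "r * n + p = r' * n + p'" by (metis of_nat_add of_nat_eq_iff of_nat_mult)
  then have "(r * n + p) div n = (r' * n + p') div n" "(r * n + p) mod n = (r' * n + p') mod n"
    by simp_all
  then show "r = r' \<and> p = p'" using assms by simp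
qed simp

lemma writes_programs [simp]:
  "writes find_column = {''p'', ''i''}"
  "writes class_coef = {''cf'', ''r'', ''eq'', ''i''}"
  "writes toggle_rows = {''M'', ''r'', ''i''}"
  "writes eliminate = {''g'', ''i'', ''j'', ''p'', ''cf'', ''r'', ''eq'', ''M''}"
  "writes evaluate = {''v'', ''r'', ''i''}"
  "writes test_candidate = {''ex'', ''r'', ''found'', ''i'', ''x''}"
  "writes choose_column = {''q'', ''i''}"
  "writes fix_column = {''r'', ''M'', ''s''}"
  "writes phase = {''g'', ''i'', ''j'', ''p'', ''cf'', ''r'', ''eq'', ''M'', ''v'', ''ex'', ''found'', ''x'', ''q'', ''s''}"
  "writes reset = {''r'', ''s'', ''i'', ''M'', ''p''}"
  "writes increment = {''carry'', ''i'', ''d'', ''go''}"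
  "writes setup_arrays = {''rows'', ''D'', ''T'', ''go'', ''o'', ''r'', ''off''}"
  by (auto simp: find_column_def class_coef_def toggle_rows_def eliminate_def evaluate_def test_candidate_def
      choose_column_def fix_column_def phase_def reset_def increment_def setup_arrays_def)

text \<open>\<open>2 * n + m + 1\<close> dominates the bounds of all inner loops: \<open>n\<close>,
  \<open>m\<close>, \<open>m + n\<close>, \<open>D \<le> n\<close> and the number
  \<open>D + n + 1\<close> of phases.\<close>

locale machine = elimination +
  fixes L k :: nat
  assumes L: "2 * n + m + 1 \<le> L"
begin

definition env :: "store \<Rightarrow> bool" where
  "env s \<longleftrightarrow> s ''n'' 0 = int n \<and> s ''m'' 0 = int m \<and> s ''rows'' 0 = int (m + n) \<and>
     s ''k'' 0 = int k \<and> (\<forall>r<m+n. s ''off'' (int r) = int r * int n) \<and> (\<forall>j<m. s ''w'' (int j) = w j)"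

definition holds_rows :: "store \<Rightarrow> (nat \<Rightarrow> nat set) \<Rightarrow> bool" where
  "holds_rows s X \<longleftrightarrow> (\<forall>r<m+n. \<forall>p<n. s ''M'' (int r * int n + int p) = of_bool (p \<in> X r))"

definition holds_signs :: "store \<Rightarrow> (nat \<Rightarrow> int) \<Rightarrow> bool" where
  "holds_signs s \<sigma> \<longleftrightarrow> (\<forall>r<m+n. s ''s'' (int r) = \<sigma> r)"

definition holds_pivots :: "store \<Rightarrow> (nat \<Rightarrow> int) \<Rightarrow> bool" where
  "holds_pivots s g \<longleftrightarrow> (\<forall>p<n. s ''g'' (int p) = g p)"

lemma env_cong:
  "s' ''n'' = s ''n'' \<Longrightarrow> s' ''m'' = s ''m'' \<Longrightarrow> s' ''rows'' = s ''rows'' \<Longrightarrow> s' ''k'' = s ''k'' \<Longrightarrow>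
    s' ''off'' = s ''off'' \<Longrightarrow> s' ''w'' = s ''w'' \<Longrightarrow> env s' \<longleftrightarrow> env s"
  by (simp add: env_def)

lemma holds_rows_cong: "s' ''M'' = s ''M'' \<Longrightarrow> holds_rows s' X \<longleftrightarrow> holds_rows s X"
  by (simp add: holds_rows_def)

lemma holds_signs_cong: "s' ''s'' = s ''s'' \<Longrightarrow> holds_signs s' X \<longleftrightarrow> holds_signs s X"
  by (simp add: holds_signs_def)

lemma holds_pivots_cong: "s' ''g'' = s ''g'' \<Longrightarrow> holds_pivots s' X \<longleftrightarrow> holds_pivots s X"
  by (simp add: holds_pivots_def)

lemmas holds_cong = env_cong holds_rows_cong holds_signs_cong holds_pivots_cong

lemma holds_rows_ext:
  "holds_rows s X \<Longrightarrow> (\<And>r p. r < m + n \<Longrightarrow> p < n \<Longrightarrow> p \<in> X r \<longleftrightarrow> p \<in> Y r) \<Longrightarrow> holds_rows s Y"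
  by (simp add: holds_rows_def)

lemma holds_rows_update:
  assumes "holds_rows s X" "r < m + n" "p < n"
  shows "holds_rows (s(''M'' := (s ''M'')(int r * int n + int p := of_bool c)))
    (X(r := {q. if q = p then c else q \<in> X r}))"
  unfolding holds_rows_def
proof (intro allI impI)
  fix r' p' assume "r' < m + n" "p' < n"
  then show "(s(''M'' := (s ''M'')(int r * int n + int p := of_bool c))) ''M'' (int r' * int n + int p') =
      of_bool (p' \<in> (X(r := {q. if q = p then c else q \<in> X r})) r')"
    using assms index_eq[of p' n p r' r] unfolding holds_rows_def by auto
qed

section \<open>Correctness of the program parts that make up a phase\<close>

lemma wp_find_column:
  assumes "env s" "holds_rows s X" "holds_pivots s g" "s ''j'' 0 = int j" "j < m"
  shows "wp L find_column s (\<lambda>s'. s' ''p'' 0 = int (column X g j))"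
  unfolding find_column_def
proof (rule wp_Seq, rule wp_Assign, rule wp_For[where M = n and
      Inv = "\<lambda>i s'. s' ''p'' 0 = int (latest (\<lambda>i. i \<in> X j \<and> g i = 0) n i)"], goal_cases)
  case (1 i s')
  have "s ''off'' (int j) = int j * int n" "s ''M'' (int j * int n + int i) = of_bool (i \<in> X j)"
    "s ''g'' (int i) = g i"
    using assms 1(1) by (simp_all add: env_def holds_rows_def holds_pivots_def)
  then show ?case using 1(1-3) assms(4)
    by (intro wp_Cond wp_Assign wp_Skip) (auto simp: 1(4) split: if_splits)
qed (use assms L in \<open>simp_all add: env_def column_def\<close>)

lemma row_eq:
  assumes "bounded_rows X" "r < m + n" "j < m + n"
  shows "(\<forall>i<n. i \<in> X r \<longleftrightarrow> i \<in> X j) \<longleftrightarrow> X r = X j"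
  using assms unfolding bounded_rows_def by blast

lemma wp_class_coef:
  assumes "env s" "holds_rows s X" "holds_signs s \<sigma>" "signs \<sigma>" "bounded_rows X"
    "s ''j'' 0 = int j" "j < m"
  shows "wp L class_coef s (\<lambda>s'. s' ''cf'' 0 = coef X \<sigma> (X j))"
  unfolding class_coef_def
proof (rule wp_Seq, rule wp_Assign, rule wp_For[where M = m and
      Inv = "\<lambda>r s'. s' ''cf'' 0 = (\<Sum>i<r. if X i = X j then w i * \<sigma> i else 0)"], goal_cases)
  case (1 r s')
  note r = 1
  have cell: "s ''M'' (int r * int n + int i) = of_bool (i \<in> X r)"
    "s ''M'' (int j * int n + int i) = of_bool (i \<in> X j)" if "i < n" for i
    using assms r(1) that by (auto simp: holds_rows_def)
  show ?case
  proof (rule wp_Seq, rule wp_Assign, rule wp_Seq, rule wp_For[where M = n and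
      Inv = "\<lambda>i s'. s' ''eq'' 0 = of_bool (\<forall>p<i. p \<in> X r \<longleftrightarrow> p \<in> X j)"], goal_cases)
    case (1 i s'')
    have "s ''off'' (int j) = int j * int n" "s ''off'' (int r) = int r * int n"
      using assms r(1) by (simp_all add: env_def)
    then show ?case using assms(6) r(3) cell[OF 1(1)] 1(1-3)
      by (intro wp_Cond wp_Assign wp_Skip) (auto simp: 1(4) r(4) less_Suc_eq split: if_splits)
  next
    case (2 s'')
    have "\<sigma> r = 1 \<or> \<sigma> r = -1" using assms(4) by (simp add: signs_def)
    moreover have "s ''w'' (int r) = w r" "s ''s'' (int r) = \<sigma> r"
      using assms r(1) by (simp_all add: env_def holds_signs_def)
    ultimately show ?case
      using r(1-3) 2(1) row_eq[OF assms(5), of r j] assms(7)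
      by (intro wp_Cond wp_Assign wp_Skip) (auto simp: 2(2) r(4))
  next
    case 3
    then show ?case using assms(1) by (simp add: r(4) env_def)
  qed (use L in simp_all)
qed (use assms(1) L in \<open>simp_all add: env_def coef_def\<close>)

lemma wp_toggle_rows:
  assumes "env s" "holds_rows s X" "s ''j'' 0 = int j" "j < m" "s ''p'' 0 = int p" "p < n"
  shows "wp L toggle_rows s (\<lambda>s'. holds_rows s' (\<lambda>r. toggle (X j) p (X r)))"
  unfolding toggle_rows_def
proof (rule wp_For[where M = n and Inv = "\<lambda>i s'. holds_rows s'
      (\<lambda>r. {q. (q \<in> X r) \<noteq> (q < i \<and> p \<in> X r \<and> q \<in> X j \<and> q \<noteq> p)})"], goal_cases)
  case (1 i s')
  note i = 1
  have ij: "s' ''M'' (int j * int n + int i) = of_bool (i \<in> X j)"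
    using i(1,2) assms(4) by (simp add: holds_rows_def)
  have vars': "s' ''j'' 0 = int j" "s' ''p'' 0 = int p" "s' ''off'' (int j) = int j * int n"
    using assms by (simp_all add: i(4) env_def)
  show ?case
  proof (rule wp_Cond, rule wp_For[where M = "m + n" and Inv = "\<lambda>r s'. holds_rows s'
      (\<lambda>r'. {q. (q \<in> X r') \<noteq> ((q < i \<or> q = i \<and> r' < r) \<and> p \<in> X r' \<and> q \<in> X j \<and> q \<noteq> p)})"],
      goal_cases)
    case (1 r s'')
    have e: "i \<in> X j" "i \<noteq> p" using 1(1) i(3) ij vars' by (auto split: if_splits)
    have rp: "s'' ''M'' (int r * int n + int p) = of_bool (p \<in> X r)"
      using 1(2,3) assms(6) by (simp add: holds_rows_def)
    have ri: "s'' ''M'' (int r * int n + int i) = of_bool (i \<in> X r)"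
      using 1(2,3) i(1) e by (simp add: holds_rows_def)
    have vars: "s'' ''p'' 0 = int p" "s'' ''i'' 0 = int i" "s'' ''r'' 0 = int r"
      "s'' ''off'' (int r) = int r * int n"
      using 1(2,4) i(3) assms(1,5) by (simp_all add: 1(5) i(4) env_def)
    show ?case
    proof (intro wp_Cond wp_Assign wp_Skip)
      assume b: "bval (Less (N 0) (Entry (Var ''r'') (Var ''p''))) s''"
      then have p: "p \<in> X r" using rp vars by (simp split: if_splits)
      have 2: "aval (Minus (N 1) (Entry (Var ''r'') (Var ''i''))) s'' = of_bool (i \<notin> X r)"
        using ri vars by simp
      have 3: "aval (Plus (Cell ''off'' (Var ''r'')) (Var ''i'')) s'' = int r * int n + int i"
        using vars by simp
      show "holds_rows (s''(''M'' := (s'' ''M'')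
          (aval (Plus (Cell ''off'' (Var ''r'')) (Var ''i'')) s'' :=
           aval (Minus (N 1) (Entry (Var ''r'') (Var ''i''))) s'')))
         (\<lambda>r'. {q. (q \<in> X r') \<noteq> ((q < i \<or> q = i \<and> r' < Suc r) \<and> p \<in> X r' \<and> q \<in> X j \<and> q \<noteq> p)})"
        unfolding 2 3
        by (rule holds_rows_ext[OF holds_rows_update[OF 1(3,2) i(1)]])
          (use e p in \<open>auto simp: less_Suc_eq\<close>)
    next
      assume "\<not> bval (Less (N 0) (Entry (Var ''r'') (Var ''p''))) s''"
      then have "p \<notin> X r" using rp vars by auto
      then show "holds_rows s''
         (\<lambda>r'. {q. (q \<in> X r') \<noteq> ((q < i \<or> q = i \<and> r' < Suc r) \<and> p \<in> X r' \<and> q \<in> X j \<and> q \<noteq> p)})"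
        using 1(3) by (rule_tac holds_rows_ext) (auto simp: less_Suc_eq)
    qed
  next
    case (2 s'')
    from 2(2) show ?case by (rule holds_rows_ext) (auto simp: less_Suc_eq)
  next
    case 9
    from i(2) show ?case by (rule holds_rows_ext) simp
  next
    case 10
    \<comment> \<open>Column \<open>i\<close> is one that \<open>toggle\<close> leaves alone, so the
      invariant advances without an update.\<close>
    have "i \<notin> X j \<or> i = p" using 10 i(3) ij vars' by (auto split: if_splits)
    then have "holds_rows s' (\<lambda>r. {q. (q \<in> X r) \<noteq> (q < Suc i \<and> p \<in> X r \<and> q \<in> X j \<and> q \<noteq> p)})"
      by (intro holds_rows_ext[OF i(2)]) (auto simp: less_Suc_eq)
    then show ?case by (rule wp_Skip)
  next
    case (8 r s'' v)
    then show ?case by (simp add: holds_rows_def)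
  next
    case 3
    then show ?case using assms(1) by (simp add: i(4) env_def)
  qed (use L in simp_all)
next
  case (2 s')
  from 2(1) show ?case by (rule holds_rows_ext) (auto simp: toggle_def)
next
  case (8 i s' v)
  then show ?case by (simp add: holds_rows_def)
next
  case 9
  from assms(2) show ?case by (rule holds_rows_ext) auto
qed (use assms(1) L in \<open>simp_all add: env_def\<close>)

lemma wp_eliminate:
  assumes env: "env s" and rows: "holds_rows s X" and sg: "holds_signs s \<sigma>" "signs \<sigma>"
    and X: "bounded_rows X"
  shows "wp L eliminate s (\<lambda>s'. holds_rows s' (fst (elim X \<sigma> m)) \<and> holds_pivots s' (snd (elim X \<sigma> m)))"
  unfolding eliminate_def
proof (rule wp_Seq, rule wp_For[where M = n and Inv = "\<lambda>i s'. \<forall>p<i. s' ''g'' (int p) = 0"], goal_cases)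
  case (1 i s')
  then show ?case by (intro wp_Assign) (auto simp: less_Suc_eq)
next
  case (2 s1)
  note s1 = 2
  show ?case
  proof (rule wp_For[where M = m and Inv = "\<lambda>j s'. holds_rows s' (fst (elim X \<sigma> j)) \<and>
      holds_pivots s' (snd (elim X \<sigma> j))"], goal_cases)
    case (1 j s2)
    note s2 = 1
    obtain X1 g1 where e: "elim X \<sigma> j = (X1, g1)" by fastforce
    have X1: "bounded_rows X1" using elim_invariant[OF X less_imp_le[OF s2(1)] e] by simp
    have E: "holds_rows s2 X1" "holds_pivots s2 g1" "env s2" "holds_signs s2 \<sigma>"
      using s2(2) e env sg by (simp_all add: holds_cong[of s2 s1] holds_cong[of s1 s] s2(4) s1(2))
    show ?case
    proof (rule wp_Seq, rule wp_mono[OF wp_find_column[OF E(3,1,2) s2(3,1)]], rule wp_Seq, goal_cases)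
      case (1 s3)
      note s3 = 1
      have E3: "holds_rows s3 X1" "holds_pivots s3 g1" "env s3" "holds_signs s3 \<sigma>" "s3 ''j'' 0 = int j"
        using E s2(3) by (simp_all add: holds_cong[of s3 s2] s3(2))
      show ?case
      proof (rule wp_mono[OF wp_class_coef[OF E3(3,1,4) sg(2) X1 E3(5) s2(1)]], goal_cases)
        case (1 s4)
        note s4 = 1
        let ?p = "column X1 g1 j" and ?c = "coef X1 \<sigma> (X1 j)"
        have E4: "holds_rows s4 X1" "holds_pivots s4 g1" "env s4" "s4 ''j'' 0 = int j"
            "s4 ''p'' 0 = int ?p" "s4 ''n'' 0 = int n"
          using E3 s3(1) by (simp_all add: holds_cong[of s4 s3] s4(2)) (simp add: env_def)
        have b: "bval (BAnd (Less (Var ''p'') (Var ''n'')) (BNot (Eq (Var ''cf'') (N 0)))) s4 \<longleftrightarrow>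
            ?p < n \<and> ?c \<noteq> 0"
          using E4(5,6) s4(1) by auto
        show ?case
        proof (rule wp_Cond, rule wp_Seq, unfold b, goal_cases)
          case 1
          then show ?case
          proof (intro wp_mono[OF wp_toggle_rows[OF E4(3,1,4) s2(1) E4(5)]], goal_cases)
            case (2 s5)
            have E5: "holds_pivots s5 g1" "s5 ''p'' 0 = int ?p" "s5 ''cf'' 0 = ?c"
              using E4 s4(1) by (simp_all add: holds_cong[of s5 s4] 2(3))
            have "elim X \<sigma> (Suc j) = (\<lambda>r. toggle (X1 j) ?p (X1 r), g1(?p := sgn ?c))"
              using 2(1) e by (simp add: Let_def)
            then show ?case using 2(1,2) E5
              by (intro wp_Cond wp_Assign) (auto simp: holds_pivots_def holds_rows_def)
          qed simp
        next
          case 2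
          then have "elim X \<sigma> (Suc j) = (X1, g1)" using e by (auto simp: Let_def)
          then show ?case using E4 by (intro wp_Skip) simp
        qed
      qed
    qed
  next
    case 3
    then show ?case using env by (simp add: s1(2) env_def)
  next
    case (8 j s v)
    then show ?case by (simp add: holds_rows_def holds_pivots_def holds_signs_def)
  next
    case 9
    then show ?case using rows s1(1) by (simp add: holds_cong[of s1 s] s1(2)) (simp add: holds_pivots_def)
  qed (use L in simp_all)
qed (use env L in \<open>simp_all add: env_def\<close>)

lemma wp_evaluate:
  assumes env: "env s" and rows: "holds_rows s X" and sg: "holds_signs s \<sigma>"
    and pv: "holds_pivots s g" "\<And>p. g p \<in> {-1, 0, 1}" and X: "bounded_rows X"
  shows "wp L evaluate s (\<lambda>s'. \<forall>r<m+n. s' ''v'' (int r) = val X \<sigma> (opposite g) r)"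
  unfolding evaluate_def
proof (rule wp_For[where M = "m + n" and
      Inv = "\<lambda>r s'. \<forall>u<r. s' ''v'' (int u) = val X \<sigma> (opposite g) u"], goal_cases)
  case (1 r s1)
  note s1 = 1
  have cell: "s ''off'' (int r) = int r * int n" "s ''s'' (int r) = \<sigma> r"
    using env sg s1(1) by (simp_all add: env_def holds_signs_def)
  show ?case
  proof (rule wp_Seq, rule wp_Assign, rule wp_For[where M = n and
      Inv = "\<lambda>i s'. (\<forall>u<r. s' ''v'' (int u) = val X \<sigma> (opposite g) u) \<and>
        s' ''v'' (int r) = \<sigma> r * (\<Prod>p\<in>X r \<inter> {..<i}. opposite g p)"], goal_cases)
    case (1 i s2)
    note s2 = 1
    have "X r \<inter> {..<Suc i} = (if i \<in> X r then insert i (X r \<inter> {..<i}) else X r \<inter> {..<i})"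
      by (auto simp: less_Suc_eq)
    then have "(\<Prod>p\<in>X r \<inter> {..<Suc i}. opposite g p) =
        (if i \<in> X r \<and> g i = 1 then -1 else 1) * (\<Prod>p\<in>X r \<inter> {..<i}. opposite g p)"
      using pv(2)[of i] by (auto simp: opposite_def)
    moreover have "s2 ''M'' (int r * int n + int i) = of_bool (i \<in> X r)" "s2 ''g'' (int i) = g i"
      using rows pv(1) s1(1) s2(1) by (simp_all add: s2(4) s1(4) holds_rows_def holds_pivots_def)
    moreover have "0 < g i \<longleftrightarrow> g i = 1" using pv(2)[of i] by auto
    moreover have "s2 ''off'' (int r) = int r * int n" "s2 ''r'' 0 = int r"
      using cell s1(3) by (simp_all add: s2(4) s1(4))
    ultimately show ?case using s2(1-3)
      by (intro wp_Cond wp_Assign wp_Skip) (auto split: if_splits)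
  next
    case (2 s2)
    have "X r \<inter> {..<n} = X r" using X s1(1) by (auto simp: bounded_rows_def)
    then show ?case using 2(1) by (auto simp: less_Suc_eq val_def)
  next
    case 3
    then show ?case using env by (simp add: s1(4) env_def)
  next
    case 9
    then show ?case using s1(1-3) cell by (simp add: s1(4))
  qed (use L in simp_all)
qed (use env L in \<open>simp_all add: env_def\<close>)

lemma wp_test_candidate:
  assumes env: "env s" and v: "\<forall>r<m+n. s ''v'' (int r) = z r \<and> (z r = 1 \<or> z r = -1)"
  shows "wp L test_candidate s (\<lambda>s'. if total z < int (2 * k)
    then s' ''found'' = s ''found'' \<and> s' ''x'' = s ''x''
    else s' ''found'' 0 = 1 \<and> (\<forall>i<n. s' ''x'' (int i + 1) = z (m + i)))"
  unfolding test_candidate_def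
proof (rule wp_Seq, rule wp_Assign, rule wp_Seq, rule wp_For[where M = m and
      Inv = "\<lambda>r s'. s' ''ex'' 0 = (\<Sum>u<r. w u * z u)"], goal_cases)
  case (1 r s1)
  have "s ''v'' (int r) = z r" "z r = 1 \<or> z r = -1" "s ''w'' (int r) = w r"
    using env v 1(1) by (simp_all add: env_def)
  then show ?case using 1(1-3) by (intro wp_Cond wp_Assign) (auto simp: 1(4))
next
  case (2 s1)
  note s1 = 2
  have E: "s1 ''k'' 0 = int k" "s1 ''n'' 0 = int n" "s1 ''m'' 0 = int m"
    using env by (simp_all add: s1(2) env_def)
  have ex: "s1 ''ex'' 0 = total z" using s1(1) by (simp add: total_def)
  show ?case
  proof (rule wp_Cond, rule wp_Skip, goal_cases)
    case 1
    then show ?case using E ex by (simp add: s1(2))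
  next
    case 2
    then have "\<not> total z < int (2 * k)" using E ex by simp
    moreover have "wp L (For ''i'' ''n''
             (Assign ''x'' (Plus (Var ''i'') (N 1)) (Cell ''v'' (Plus (Var ''m'') (Var ''i'')))))
           (s1(''found'' := (s1 ''found'')(0 := 1)))
           (\<lambda>s'. s' ''found'' 0 = 1 \<and> (\<forall>i<n. s' ''x'' (int i + 1) = z (m + i)))"
    proof (rule wp_For[where M = n and
        Inv = "\<lambda>i s'. s' ''found'' 0 = 1 \<and> (\<forall>u<i. s' ''x'' (int u + 1) = z (m + u))"], goal_cases)
      case (1 i s2)
      have "s ''v'' (int m + int i) = z (m + i)" using v 1(1) by (metis add_strict_left_mono of_nat_add)
      then show ?case using 1(1-3) E by (intro wp_Assign) (auto simp: 1(4) s1(2) less_Suc_eq)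
    qed (use E L in simp_all)
    ultimately show ?case by (intro wp_Seq wp_Assign) simp
  qed
qed (use env L in \<open>simp_all add: env_def\<close>)

lemma wp_choose_column:
  assumes env: "env s" and pv: "holds_pivots s g" and t: "s ''t'' 0 = int t" "s ''D'' 0 = int D"
    and d: "\<forall>i<D. s ''d'' (int i) = int (d i)"
  shows "wp L choose_column s (\<lambda>s'. s' ''q'' 0 = int (choice D d t g))"
  unfolding choose_column_def
proof (rule wp_Cond, rule wp_Assign, goal_cases)
  case 1
  then show ?case using t d by (simp add: choice_def)
next
  case 2
  show ?case
  proof (rule wp_Seq, rule wp_Assign, rule wp_For[where M = n and
        Inv = "\<lambda>i s'. s' ''q'' 0 = int (latest (\<lambda>i. g i \<noteq> 0) n i)"], goal_cases)
    case (1 i s1)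
    have "s ''g'' (int i) = g i" using pv 1(1) by (simp add: holds_pivots_def)
    then show ?case using 1(1-3) by (intro wp_Cond wp_Skip wp_Assign) (auto simp: 1(4))
  next
    case (2 s1)
    then show ?case using \<open>\<not> bval (Less (Var ''t'') (Var ''D'')) s\<close> t by (simp add: choice_def)
  qed (use env L in \<open>simp_all add: env_def\<close>)
qed

lemma wp_fix_column:
  assumes env: "env s" and rows: "holds_rows s X" and sg: "holds_signs s \<sigma>"
    and pv: "holds_pivots s g" "\<And>p. g p \<in> {-1, 0, 1}" "\<And>p. g p \<noteq> 0 \<Longrightarrow> p < n"
    and q: "s ''q'' 0 = int q"
  shows "wp L fix_column s (\<lambda>s'.
    if g q \<noteq> 0 then holds_rows s' (fix_rows q X) \<and> holds_signs s' (fix_signs q (g q) X \<sigma>)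
    else holds_rows s' X \<and> holds_signs s' \<sigma>)"
proof -
  \<comment> \<open>For \<open>q < n\<close> the cell holds \<open>g q\<close>; for larger
    \<open>q\<close> the bounds test fails and \<open>g q = 0\<close> as well.\<close>
  have b: "bval (BAnd (Less (Var ''q'') (Var ''n'')) (BNot (Eq (Cell ''g'' (Var ''q'')) (N 0)))) s \<longleftrightarrow> g q \<noteq> 0"
    using env pv(1) pv(3)[of q] q by (auto simp: env_def holds_pivots_def)
  show ?thesis unfolding fix_column_def
  proof (rule wp_Cond, unfold b, goal_cases)
    case 1
    then have qn: "q < n" using pv(3) by blast
    have gq: "s ''g'' (int q) = g q" using pv(1) qn by (simp add: holds_pivots_def)
    show ?case
    proof (rule wp_For[where M = "m + n" and Inv = "\<lambda>r s'.
          holds_rows s' (\<lambda>u. if u < r then X u - {q} else X u) \<and>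
          holds_signs s' (\<lambda>u. if u < r \<and> q \<in> X u then g q * \<sigma> u else \<sigma> u)"], goal_cases)
      case (1 r s1)
      note s1 = 1
      have E: "s1 ''q'' 0 = int q" "s1 ''off'' (int r) = int r * int n" "s1 ''g'' (int q) = g q"
        using env q gq s1(1) by (simp_all add: s1(4) env_def)
      have c: "s1 ''M'' (int r * int n + int q) = of_bool (q \<in> X r)" "s1 ''s'' (int r) = \<sigma> r"
        using s1(1,2) qn by (simp_all add: holds_rows_def holds_signs_def)
      show ?case
      proof (rule wp_Cond, goal_cases)
        case 1
        then have qX: "q \<in> X r" using E c s1(3) by (auto split: if_splits)
        let ?s = "s1(''M'' := (s1 ''M'')(int r * int n + int q := of_bool False))"
        have R: "holds_rows ?s (\<lambda>u. if u < Suc r then X u - {q} else X u)"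
          by (rule holds_rows_ext[OF holds_rows_update[OF conjunct1[OF s1(2)] s1(1) qn]]) auto
        have "g q = 1 \<or> g q = -1" using \<open>g q \<noteq> 0\<close> pv(2)[of q] by auto
        then have "wp L (Cond (Less (Cell ''g'' (Var ''q'')) (N 0))
             (Assign ''s'' (Var ''r'') (Minus (N 0) (Cell ''s'' (Var ''r'')))) Skip) ?s
            (\<lambda>s'. holds_rows s' (\<lambda>u. if u < Suc r then X u - {q} else X u) \<and>
              holds_signs s' (\<lambda>u. if u < Suc r \<and> q \<in> X u then g q * \<sigma> u else \<sigma> u))"
          using R E c s1(1-3) qX
          by (intro wp_Cond wp_Assign wp_Skip) (auto simp: holds_signs_def holds_rows_def less_Suc_eq)
        then show ?case using E s1(3) by (intro wp_Seq wp_Assign) simp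
      next
        case 2
        then have qX: "q \<notin> X r" using E c s1(3) by auto
        have "holds_rows s1 (\<lambda>u. if u < Suc r then X u - {q} else X u)"
          by (rule holds_rows_ext[OF conjunct1[OF s1(2)]]) (use qX in \<open>auto simp: less_Suc_eq\<close>)
        then show ?case using s1(2) qX by (intro wp_Skip) (auto simp: holds_signs_def less_Suc_eq)
      qed
    next
      case (2 s1)
      have "holds_rows s1 (fix_rows q X)"
        by (rule holds_rows_ext[OF conjunct1[OF 2(1)]]) (simp add: fix_rows_def)
      then show ?case using 2(1) \<open>g q \<noteq> 0\<close> by (simp add: holds_signs_def fix_signs_def)
    next
      case (8 r s1 v)
      then show ?case by (simp add: holds_rows_def holds_pivots_def holds_signs_def)
    next
      case 9
      then show ?case using rows sg by simp
    qed (use env L in \<open>simp_all add: env_def\<close>)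
  next
    case 2
    then show ?case using rows sg by (intro wp_Skip) simp
  qed
qed

end

subsection \<open>Running through all sequences of choices\<close>

lemma mod_power_Suc_eq_0_iff:
  "0 < n \<Longrightarrow> (a::nat) mod n ^ Suc i = 0 \<longleftrightarrow> a mod n ^ i = 0 \<and> a div n ^ i mod n = 0"
  using mod_mult2_eq[of a "n ^ i" n] by (auto simp: mult.commute)

definition digit :: "nat \<Rightarrow> nat \<Rightarrow> nat \<Rightarrow> nat" where
  "digit n a i = a div n ^ i mod n"

text \<open>The carry into position \<open>i\<close> is the divisibility of \<open>Suc a\<close> by
  \<open>n ^ i\<close>, that is, all lower digits have wrapped around to 0; the second part is its
  propagation.\<close>

lemma digit_Suc:
  assumes "0 < n"
  shows "digit n (Suc a) i = (if Suc a mod n ^ i = 0 then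
      if Suc (digit n a i) < n then Suc (digit n a i) else 0 else digit n a i)"
    and "Suc a mod n ^ Suc i = 0 \<longleftrightarrow> Suc a mod n ^ i = 0 \<and> \<not> Suc (digit n a i) < n"
proof -
  have lt: "digit n a i < n" using assms by (simp add: digit_def)
  have d: "digit n (Suc a) i = (if Suc a mod n ^ i = 0 then Suc (a div n ^ i) mod n else digit n a i)"
    unfolding digit_def div_Suc by simp
  have s: "Suc (a div n ^ i) mod n = (if Suc (digit n a i) < n then Suc (digit n a i) else 0)"
    using lt unfolding mod_Suc by (auto simp: digit_def)
  show *: "digit n (Suc a) i = (if Suc a mod n ^ i = 0 then
      if Suc (digit n a i) < n then Suc (digit n a i) else 0 else digit n a i)"
    unfolding d s ..
  show "Suc a mod n ^ Suc i = 0 \<longleftrightarrow> Suc a mod n ^ i = 0 \<and> \<not> Suc (digit n a i) < n"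
    using mod_power_Suc_eq_0_iff[OF assms, of "Suc a" i] * unfolding digit_def[of n "Suc a"] by auto
qed

lemma digits_exist:
  "(\<forall>i<D. d i < n) \<Longrightarrow> \<exists>a<n ^ D. \<forall>i<D. digit n a i = d i"
proof (induction D arbitrary: d)
  case 0
  then show ?case by (intro exI[of _ 0]) simp
next
  case (Suc D)
  then obtain a where a: "a < n ^ D" "\<forall>i<D. digit n a i = d (Suc i)"
    using Suc.IH[of "\<lambda>i. d (Suc i)"] Suc.prems by fastforce
  have d0: "d 0 < n" using Suc.prems by simp
  \<comment> \<open>Digit 0 is the least significant one, so it goes below the number
    \<open>a\<close> that codes the shifted sequence.\<close>
  let ?b = "d 0 + n * a"
  have b: "?b div n = a" "?b mod n = d 0" using d0 by simp_all
  have "digit n ?b i = d i" if "i < Suc D" for i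
  proof (cases i)
    case 0
    then show ?thesis using b by (simp add: digit_def)
  next
    case (Suc l)
    have "?b div n ^ Suc l = a div n ^ l" using b by (simp add: div_mult2_eq)
    then show ?thesis using a that Suc by (simp add: digit_def)
  qed
  moreover have "?b < n ^ Suc D"
  proof -
    have "?b < n * Suc a" using d0 by simp
    also have "\<dots> \<le> n * n ^ D" using a by (intro mult_le_mono2) simp
    finally show ?thesis by simp
  qed
  ultimately show ?case by blast
qed

locale search = machine n m w L k + branching n m w X0 \<sigma>0 D
  for n m w L k X0 \<sigma>0 D +
  assumes D: "D = min (2 * k) n" and signs0: "signs \<sigma>0"
    and unit_rows: "\<And>p. p < n \<Longrightarrow> X0 (m + p) = {p} \<and> \<sigma>0 (m + p) = 1"
begin

definition inputs :: "store \<Rightarrow> bool" where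
  "inputs s \<longleftrightarrow> (\<forall>r<m. s ''b'' (int r) = \<sigma>0 r) \<and>
     (\<forall>r<m. \<forall>i<n. s ''A'' (int r * int n + int i) = of_bool (i \<in> X0 r))"

text \<open>The witness \<open>z\<close> need not be the current candidate: an answer stays valid
  through all later trials.\<close>

definition sound :: "store \<Rightarrow> bool" where
  "sound s \<longleftrightarrow> s ''found'' 0 = 0 \<or> s ''found'' 0 = 1 \<and>
     (\<exists>z. reach X0 \<sigma>0 z \<and> int (2 * k) \<le> total z \<and> (\<forall>i<n. s ''x'' (int i + 1) = z (m + i)))"

definition control :: "store \<Rightarrow> (nat \<Rightarrow> nat) \<Rightarrow> bool" where
  "control s d \<longleftrightarrow> s ''D'' 0 = int D \<and> s ''T'' 0 = int (Suc (D + n)) \<and>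
     (\<forall>i<D. s ''d'' (int i) = int (d i))"

lemma inputs_cong: "s' ''b'' = s ''b'' \<Longrightarrow> s' ''A'' = s ''A'' \<Longrightarrow> inputs s' \<longleftrightarrow> inputs s"
  by (simp add: inputs_def)

lemma control_cong:
  "s' ''D'' = s ''D'' \<Longrightarrow> s' ''T'' = s ''T'' \<Longrightarrow> s' ''d'' = s ''d'' \<Longrightarrow> control s' d \<longleftrightarrow> control s d"
  by (simp add: control_def)

lemma state_signs: "signs (snd (state d t))"
proof (induction t)
  case 0
  then show ?case using signs0 by simp
next
  case (Suc t)
  obtain X \<sigma> where s: "state d t = (X, \<sigma>)" by fastforce
  obtain X' g where e: "elim X \<sigma> m = (X', g)" by fastforce
  have X: "bounded_rows X" using state_sound[OF s] by simp
  have g: "g q \<in> {-1, 0, 1}" for q using elim_signs[OF X e] .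
  have "signs (fix_signs q (g q) X' \<sigma>)" if "g q \<noteq> 0" for q
    using Suc s g[of q] that unfolding signs_def fix_signs_def by force
  then show ?case using Suc s e by (auto simp: advance_def Let_def)
qed

lemma wp_phase:
  assumes env: "env s" and ctl: "control s d" and t: "s ''t'' 0 = int t"
    and rows: "holds_rows s (fst (state d t))" and sg: "holds_signs s (snd (state d t))"
  shows "wp L phase s (\<lambda>s'. holds_rows s' (fst (state d (Suc t))) \<and>
    holds_signs s' (snd (state d (Suc t))) \<and> (sound s \<longrightarrow> sound s') \<and>
    (s' ''found'' 0 = 0 \<longrightarrow> s ''found'' 0 = 0 \<and> total (outcome d t) < int (2 * k)))"
proof -
  obtain X \<sigma> where s: "state d t = (X, \<sigma>)" by fastforce
  obtain X' g where e: "elim X \<sigma> m = (X', g)" by fastforce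
  have X: "bounded_rows X" using state_sound[OF s] by simp
  have X': "bounded_rows X'" using elim_props[OF X e] by simp
  have \<sigma>: "signs \<sigma>" using state_signs[of d t] s by simp
  have g: "g q \<in> {-1, 0, 1}" for q using elim_signs[OF X e] .
  have out: "outcome d t = val X' \<sigma> (opposite g)" by (simp add: outcome_def s candidate_def e)
  have pm: "val X' \<sigma> (opposite g) r = 1 \<or> val X' \<sigma> (opposite g) r = -1" for r
    using \<sigma> prod_signs[OF signs_opposite[OF X e], of "X' r"] unfolding val_def signs_def
    by (metis minus_mult_minus mult.left_neutral mult_minus1_right mult.right_neutral)
  show ?thesis unfolding phase_def
  proof (rule wp_Seq, rule wp_mono[OF wp_eliminate[OF env _ _ \<sigma> X]], goal_cases)
    case (3 s1)
    note s1 = 3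
    have E1: "env s1" "holds_rows s1 X'" "holds_signs s1 \<sigma>" "holds_pivots s1 g"
      using env s1(1) sg s e by (simp_all add: holds_cong[of s1 s] s1(2))
    show ?case
    proof (rule wp_Seq, rule wp_mono[OF wp_evaluate[OF E1(1-4) g X']], goal_cases)
      case (1 s2)
      note s2 = 1
      have E2: "env s2" "holds_rows s2 X'" "holds_signs s2 \<sigma>" "holds_pivots s2 g"
        using E1 by (simp_all add: holds_cong[of s2 s1] s2(2))
      have v: "\<forall>r<m+n. s2 ''v'' (int r) = outcome d t r \<and> (outcome d t r = 1 \<or> outcome d t r = -1)"
        using s2(1) pm out by simp
      show ?case
      proof (rule wp_Seq, rule wp_mono[OF wp_test_candidate[OF E2(1) v]], goal_cases)
        case (1 s3)
        note s3 = 1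
        have E3: "env s3" "holds_rows s3 X'" "holds_signs s3 \<sigma>" "holds_pivots s3 g"
          using E2 by (simp_all add: holds_cong[of s3 s2] s3(2))
        have C3: "s3 ''t'' 0 = int t" "s3 ''D'' 0 = int D" "\<forall>i<D. s3 ''d'' (int i) = int (d i)"
          using t ctl by (simp_all add: s3(2) s2(2) s1(2) control_def)
        \<comment> \<open>A success is sound by \<open>outcome_sound\<close>; a flag still 0
          certifies that this candidate failed, which is what a NO will rely on.\<close>
        have F: "(sound s \<longrightarrow> sound s3) \<and>
          (s3 ''found'' 0 = 0 \<longrightarrow> s ''found'' 0 = 0 \<and> total (outcome d t) < int (2 * k))"
        proof (cases "total (outcome d t) < int (2 * k)")
          case True
          then have "s3 ''found'' = s ''found''" "s3 ''x'' = s ''x''"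
            using s3(1) by (simp_all add: s2(2) s1(2))
          then show ?thesis using True by (simp add: sound_def)
        next
          case False
          then show ?thesis using s3(1) outcome_sound[of d t] by (auto simp: sound_def)
        qed
        show ?case
        proof (rule wp_Seq, rule wp_mono[OF wp_choose_column[OF E3(1,4) C3]], goal_cases)
          case (1 s4)
          note s4 = 1
          have E4: "env s4" "holds_rows s4 X'" "holds_signs s4 \<sigma>" "holds_pivots s4 g"
            using E3 by (simp_all add: holds_cong[of s4 s3] s4(2))
          show ?case
          proof (rule wp_mono[OF wp_fix_column[OF E4 g _ s4(1)]], goal_cases)
            case (1 q)
            then show ?case using elim_props[OF X e] by blast
          next
            case (2 s5)
            have "s5 ''found'' = s3 ''found''" "s5 ''x'' = s3 ''x''"
              by (simp_all add: 2(2) s4(2))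
            then show ?case using F 2(1) by (auto simp: s e advance_def Let_def sound_def split: if_splits)
          qed
        qed
      qed
    qed
  qed (use rows sg s in simp_all)
qed

text \<open>\<open>P\<close> marks the cells already rewritten by \<open>reset\<close>; the others
  may hold leftovers of the previous trial.\<close>

definition holds_part :: "store \<Rightarrow> (nat \<Rightarrow> nat \<Rightarrow> bool) \<Rightarrow> bool" where
  "holds_part s P \<longleftrightarrow> (\<forall>u. \<forall>p<n. P u p \<longrightarrow> s ''M'' (int u * int n + int p) = of_bool (p \<in> X0 u))"

lemma holds_part_update:
  assumes "holds_part s P" "i < n" "c = of_bool (i \<in> X0 r)"
    and "\<And>u p. P' u p \<Longrightarrow> P u p \<or> u = r \<and> p = i"
  shows "holds_part (s(''M'' := (s ''M'')(int r * int n + int i := c))) P'"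
  unfolding holds_part_def
proof (intro allI impI)
  fix u p assume "p < n" "P' u p"
  then show "(s(''M'' := (s ''M'')(int r * int n + int i := c))) ''M'' (int u * int n + int p) =
      of_bool (p \<in> X0 u)"
    using assms index_eq[of p n i u r] unfolding holds_part_def by fastforce
qed

lemma holds_part_mono:
  "holds_part s P \<Longrightarrow> (\<And>u p. p < n \<Longrightarrow> P' u p \<Longrightarrow> P u p) \<Longrightarrow> holds_part s P'"
  by (simp add: holds_part_def)

lemma wp_reset:
  assumes env: "env s" and inp: "inputs s"
  shows "wp L reset s (\<lambda>s'. holds_rows s' X0 \<and> holds_signs s' \<sigma>0)"
  unfolding reset_def
proof (rule wp_Seq, rule wp_For[where M = m and Inv = "\<lambda>r s'. holds_part s' (\<lambda>u p. u < r) \<and>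
      (\<forall>u<r. s' ''s'' (int u) = \<sigma>0 u)"], goal_cases)
  case (1 r s1)
  note s1 = 1
  have c: "s ''off'' (int r) = int r * int n" "s ''b'' (int r) = \<sigma>0 r"
    using env inp s1(1) by (simp_all add: env_def inputs_def)
  show ?case
  proof (rule wp_Seq, rule wp_Assign, rule wp_For[where M = n and
      Inv = "\<lambda>i s'. holds_part s' (\<lambda>u p. u < r \<or> u = r \<and> p < i) \<and>
        (\<forall>u<Suc r. s' ''s'' (int u) = \<sigma>0 u)"], goal_cases)
    case (1 i s2)
    note s2 = 1
    have E: "aval (Plus (Cell ''off'' (Var ''r'')) (Var ''i'')) s2 = int r * int n + int i"
      "aval (Cell ''A'' (Plus (Cell ''off'' (Var ''r'')) (Var ''i''))) s2 = of_bool (i \<in> X0 r)"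
      using c s1(1,3) s2(1,3) inp by (simp_all add: s2(4) s1(4) inputs_def)
    show ?case
      using s2(2) by (intro wp_Assign conjI, unfold E, intro holds_part_update[OF conjunct1[OF s2(2)] s2(1)])
        (auto simp: less_Suc_eq)
  next
    case (2 s2)
    then show ?case using holds_part_mono by (auto simp: less_Suc_eq intro: holds_part_mono)
  next
    case 3
    then show ?case using env by (simp add: s1(4) env_def)
  next
    case 9
    then show ?case using s1(2,3) c by (simp add: s1(4) less_Suc_eq holds_part_def)
  next
    case 8
    then show ?case by (simp add: holds_part_def)
  qed (use L in simp_all)
next
  case (2 s0)
  note s0 = 2
  show ?case
  proof (rule wp_For[where M = n and Inv = "\<lambda>q s'. holds_part s' (\<lambda>u p. u < m + q) \<and>
      (\<forall>u<m+q. s' ''s'' (int u) = \<sigma>0 u)"], goal_cases)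
    case (1 q s1)
    note s1 = 1
    have c: "s1 ''off'' (int m + int q) = int (m + q) * int n" "s1 ''m'' 0 = int m"
      using env s1(1) by (simp_all add: env_def s1(4) s0(2) flip: of_nat_add)
    show ?case
    proof (rule wp_Seq, rule wp_Assign, rule wp_For[where M = n and
        Inv = "\<lambda>i s'. holds_part s' (\<lambda>u p. u < m + q \<or> u = m + q \<and> p < i) \<and>
          (\<forall>u<Suc (m + q). s' ''s'' (int u) = \<sigma>0 u)"], goal_cases)
      case (1 i s2)
      note s2 = 1
      have E: "aval (Plus (Cell ''off'' (Plus (Var ''m'') (Var ''p''))) (Var ''i'')) s2 =
          int (m + q) * int n + int i"
        using c s1(3) s2(3) by (simp add: s2(4))
      have b: "bval (Eq (Var ''i'') (Var ''p'')) s2 \<longleftrightarrow> i = q"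
        using s1(3) s2(3) by (auto simp: s2(4))
      have *: "holds_part (s2(''M'' := (s2 ''M'')(int (m + q) * int n + int i := of_bool (i = q))))
          (\<lambda>u p. u < m + q \<or> u = m + q \<and> p < Suc i)"
        using unit_rows[OF s1(1)]
        by (intro holds_part_update[OF conjunct1[OF s2(2)] s2(1)]) (auto simp: less_Suc_eq)
      show ?case using * s2(2)
        by (intro wp_Cond wp_Assign conjI; unfold E b) auto
    next
      case (2 s2)
      then show ?case by (auto simp: less_Suc_eq intro: holds_part_mono)
    next
      case 3
      then show ?case using env by (simp add: s1(4) s0(2) env_def)
    next
      case 9
      have "\<sigma>0 (m + q) = 1" using unit_rows[OF s1(1)] by simp
      then show ?case using s1(2,3) c by (auto simp: less_Suc_eq holds_part_def)
    next
      case 8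
      then show ?case by (simp add: holds_part_def)
    qed (use L in simp_all)
  next
    case (2 s1)
    then show ?case by (simp add: holds_rows_def holds_signs_def holds_part_def)
  next
    case 3
    then show ?case using env by (simp add: s0(2) env_def)
  next
    case 9
    then show ?case using s0(1) by simp
  next
    case 8
    then show ?case by (simp add: holds_part_def)
  qed (use L in simp_all)
next
  case 8
  then show ?case by (simp add: holds_part_def)
next
  case 9
  then show ?case by (simp add: holds_part_def)
qed (use env L in \<open>simp_all add: env_def\<close>)

lemma wp_increment:
  assumes env: "env s" and ctl: "control s (digit n a)" and a: "a < n ^ D"
  shows "wp L increment s (\<lambda>s'. control s' (digit n (Suc a)) \<and>
    (if Suc a < n ^ D then s' ''go'' 0 = s ''go'' 0 else s' ''go'' 0 = 0))"
  unfolding increment_def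
proof (rule wp_Seq, rule wp_Assign, rule wp_Seq, rule wp_For[where M = D and Inv = "\<lambda>i s'.
    s' ''go'' = s ''go'' \<and> s' ''carry'' 0 = of_bool (Suc a mod n ^ i = 0) \<and>
    (\<forall>u<D. s' ''d'' (int u) = int (if u < i then digit n (Suc a) u else digit n a u))"], goal_cases)
  case (1 i s1)
  note s1 = 1
  have n: "0 < n" using s1(1) D by auto
  have E: "s1 ''n'' 0 = int n" "s1 ''d'' (int i) = int (digit n a i)"
    using env s1(1,2) by (simp_all add: s1(4) env_def)
  show ?case using s1(1-3) E digit_Suc[OF n, of a i]
    by (intro wp_Cond wp_Seq wp_Assign wp_Skip) (auto simp: less_Suc_eq simp del: power_Suc)
next
  case (2 s1)
  \<comment> \<open>As \<open>a < n ^ D\<close>, divisibility means \<open>Suc a = n ^ D\<close>: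
    the counter has overflowed.\<close>
  have "Suc a mod n ^ D = 0 \<longleftrightarrow> \<not> Suc a < n ^ D"
    using a by (cases "Suc a = n ^ D") auto
  then show ?case using 2(1) ctl by (intro wp_Cond wp_Assign wp_Skip) (auto simp: 2(2) control_def)
next
  case 4
  then show ?case using L D by simp
qed (use ctl in \<open>simp_all add: control_def\<close>)

text \<open>A flag 0 carries the failure of all earlier numbers \<open>a'\<close>, so at
  \<open>a = n ^ D\<close> it refutes every sequence of choices.\<close>

definition invariant :: "nat \<Rightarrow> store \<Rightarrow> bool" where
  "invariant a s \<longleftrightarrow> env s \<and> inputs s \<and> control s (digit n a) \<and> sound s \<and>
     s ''go'' 0 = of_bool (a < n ^ D) \<and>
     (s ''found'' 0 = 0 \<longrightarrow> (\<forall>a'<a. \<forall>t<Suc (D + n). total (outcome (digit n a') t) < int (2 * k)))"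

lemma wp_try_choices:
  assumes inv: "invariant a s" and a: "a < n ^ D"
  shows "wp L try_choices s (invariant (Suc a))"
proof -
  have I: "env s" "inputs s" "control s (digit n a)" "sound s" "s ''go'' 0 = 1"
    using inv a by (simp_all add: invariant_def)
  show ?thesis unfolding try_choices_def
  proof (rule wp_Seq, rule wp_mono[OF wp_reset[OF I(1,2)]], rule wp_Seq, goal_cases)
    case (1 s1)
    note s1 = 1
    have E1: "env s1" "inputs s1" "control s1 (digit n a)" "sound s1"
      using I by (simp_all add: s1(2) holds_cong[of s1 s] inputs_cong[of s1 s] control_cong[of s1 s] sound_def)
    show ?case
    proof (rule wp_For[where M = "Suc (D + n)" and Inv = "\<lambda>t s'.
        holds_rows s' (fst (state (digit n a) t)) \<and> holds_signs s' (snd (state (digit n a) t)) \<and>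
        sound s' \<and> (s' ''found'' 0 = 0 \<longrightarrow> s ''found'' 0 = 0 \<and>
          (\<forall>u<t. total (outcome (digit n a) u) < int (2 * k)))"], goal_cases)
      case (1 t s2)
      note s2 = 1
      have E2: "env s2" "control s2 (digit n a)"
        using E1 by (simp_all add: s2(4) holds_cong[of s2 s1] control_cong[of s2 s1])
      show ?case
        by (rule wp_mono[OF wp_phase[OF E2 s2(3)]]) (use s2(2) in \<open>auto simp: less_Suc_eq\<close>)
    next
      case (2 s2)
      note s2 = 2
      have E2: "env s2" "control s2 (digit n a)" "inputs s2"
        using E1 by (simp_all add: s2(2) holds_cong[of s2 s1] control_cong[of s2 s1] inputs_cong[of s2 s1])
      have go: "s2 ''go'' 0 = 1" using I(5) by (simp add: s2(2) s1(2))
      show ?case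
      proof (rule wp_mono[OF wp_increment[OF E2(1,2) a]], goal_cases)
        case (1 s3)
        have "env s3" "inputs s3" "sound s3"
          using E2 s2(1) by (simp_all add: 1(2) holds_cong[of s3 s2] inputs_cong[of s3 s2] sound_def)
        moreover have "s3 ''found'' = s2 ''found''" by (simp add: 1(2))
        ultimately show ?case using 1(1) go s2(1) inv
          by (auto simp: invariant_def less_Suc_eq split: if_splits)
      qed
    next
      case 3
      then show ?case using E1(3) by (simp add: control_def)
    next
      case 4
      then show ?case using L D by simp
    next
      case (8 t s' v)
      then show ?case by (simp add: holds_rows_def holds_signs_def sound_def)
    next
      case 9
      then show ?case using s1(1) E1(4) by (simp add: s1(2))
    qed simp_all
  qed
qed

lemma wp_setup:
  assumes inp: "inputs s" and init: "s ''n'' 0 = int n" "s ''m'' 0 = int m" "s ''k'' 0 = int k"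
      "\<forall>j<m. s ''w'' (int j) = w j" "s ''d'' = (\<lambda>_. 0)" "s ''found'' 0 = 0"
  shows "wp L setup_arrays s (invariant 0)"
proof -
  have fin: "wp L (For ''r'' ''rows''
         (Seq (Assign ''off'' (Var ''r'') (Var ''o''))
           (Assign ''o'' (N 0) (Plus (Var ''o'') (Var ''n''))))) s1 (invariant 0)"
    if s1: "s1 ''rows'' 0 = int (m + n)" "s1 ''D'' 0 = int D" "s1 ''T'' 0 = int (Suc (D + n))"
      "s1 ''go'' 0 = 1" "s1 ''o'' 0 = 0"
      "\<And>a. a \<notin> {''rows'', ''D'', ''T'', ''go'', ''o''} \<Longrightarrow> s1 a = s a" for s1
  proof (rule wp_For[where M = "m + n" and Inv = "\<lambda>r s'. s' ''o'' 0 = int r * int n \<and>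
      (\<forall>u<r. s' ''off'' (int u) = int u * int n)"], goal_cases)
    case (1 r s2)
    have "s2 ''n'' 0 = int n" using init by (simp add: 1(4) s1(6))
    then show ?case using 1(1-3)
      by (intro wp_Seq wp_Assign) (auto simp: less_Suc_eq algebra_simps)
  next
    case (2 s2)
    have "env s2" using 2(1) init s1(1) by (simp add: env_def 2(2) s1(6))
    moreover have "inputs s2" using inp by (simp add: 2(2) s1(6) inputs_cong[of s2 s])
    \<comment> \<open>\<open>go\<close> starts as 1 without a test; this is right even for
      \<open>n = 0\<close>, where \<open>D = 0\<close> and \<open>0 ^ 0 = 1\<close>.\<close>
    moreover have "n = 0 \<Longrightarrow> D = 0" using D by simp
    then have "s2 ''go'' 0 = of_bool (0 < n ^ D)" using s1(4) by (auto simp: 2(2))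
    moreover have "control s2 (digit n 0)" "sound s2"
      using init s1(2,3) by (simp_all add: 2(2) s1(6) control_def sound_def digit_def)
    ultimately show ?case by (simp add: invariant_def)
  qed (use s1(1,5) L in simp_all)
  show ?thesis unfolding setup_arrays_def
    by (intro wp_Seq wp_Assign wp_Cond wp_Skip fin) (use init D in \<open>auto split: if_splits\<close>)
qed

text \<open>The outer loop is the one whose number of rounds escapes \<open>L\<close>; it
  contributes the factor \<open>n ^ D\<close>, and 5 is the cost of one evaluation of its
  guard.\<close>

lemma exec_search:
  assumes "inputs s" "s ''n'' 0 = int n" "s ''m'' 0 = int m" "s ''k'' 0 = int k"
    "\<forall>j<m. s ''w'' (int j) = w j" "s ''d'' = (\<lambda>_. 0)" "s ''found'' 0 = 0"
  shows "\<exists>t s'. exec search_program s t s' \<and> t \<le> tcost L setup_arrays + 5 + n ^ D * (5 + tcost L try_choices) \<and>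
    invariant (n ^ D) s'"
proof -
  obtain t0 s0 where s0: "exec setup_arrays s t0 s0" "t0 \<le> tcost L setup_arrays" "invariant 0 s0"
    using wp_setup[OF assms] by (auto simp: wp_def)
  let ?b = "Less (N 0) (Var ''go'')"
  have "\<exists>t s'. exec (While ?b try_choices) s0 t s' \<and>
      t \<le> 1 + bcost ?b + n ^ D * (1 + bcost ?b + tcost L try_choices) \<and> invariant (n ^ D) s'"
  proof (rule exec_While)
    fix a s' assume "a < n ^ D" "invariant a s'"
    then show "bval ?b s' \<and> (\<exists>t r. exec try_choices s' t r \<and> t \<le> tcost L try_choices \<and> invariant (Suc a) r)"
      using wp_try_choices[of a s'] by (auto simp: wp_def invariant_def)
  qed (use s0 in \<open>auto simp: invariant_def\<close>)
  then obtain t s' where w: "exec (While ?b try_choices) s0 t s'"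
    "t \<le> 1 + bcost ?b + n ^ D * (1 + bcost ?b + tcost L try_choices)" "invariant (n ^ D) s'" by blast
  have b: "1 + bcost ?b = 5" by simp
  have "t0 + t \<le> tcost L setup_arrays + 5 + n ^ D * (5 + tcost L try_choices)"
    using w(2)[unfolded b] s0(2) by linarith
  then show ?thesis using exec.Seq[OF s0(1) w(1)] w(3) unfolding search_program_def by blast
qed

end

subsection \<open>Linear systems\<close>

text \<open>Variables are renumbered from 0. The rows from \<open>num_eqs S\<close> on are the
  single variables, from which the answer will be read.\<close>

definition rows_of :: "lin_system \<Rightarrow> nat \<Rightarrow> nat set" where
  "rows_of S r = (if r < num_eqs S then {i. i + 1 \<in> lhs_vars (equations S ! r)} else {r - num_eqs S})"

definition signs_of :: "lin_system \<Rightarrow> nat \<Rightarrow> int" where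
  "signs_of S r = (if r < num_eqs S then rhs (equations S ! r) else 1)"

lemma wf_equation:
  assumes "wf_system S" "r < num_eqs S"
  shows "lhs_vars (equations S ! r) \<noteq> {}" "lhs_vars (equations S ! r) \<subseteq> {1..num_vars S}"
    "rhs (equations S ! r) = 1 \<or> rhs (equations S ! r) = -1"
  using assms unfolding wf_system_def num_eqs_def by (metis insert_iff nth_mem singletonD)+

lemma lhs_vars_rows_of:
  assumes "wf_system S" "r < num_eqs S"
  shows "lhs_vars (equations S ! r) = Suc ` rows_of S r"
proof -
  have "i \<in> Suc ` rows_of S r" if "i \<in> lhs_vars (equations S ! r)" for i
    using that wf_equation(2)[OF assms] assms(2) by (cases i) (auto simp: rows_of_def)
  then show ?thesis using assms(2) by (auto simp: rows_of_def)
qed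

lemma input_store_matrix:
  assumes "r < num_eqs S" "i < num_vars S"
  shows "input_store S k ''A'' (int r * int (num_vars S) + int i) = of_bool (i \<in> rows_of S r)"
proof -
  let ?n = "num_vars S" and ?q = "int r * int (num_vars S) + int i"
  have q: "?q = int (r * ?n + i)" by simp
  have "r * ?n + i < Suc r * ?n" using assms(2) by simp
  also have "\<dots> \<le> num_eqs S * ?n" using assms(1) by (intro mult_le_mono1) simp
  finally have "0 \<le> ?q \<and> ?q < int (num_eqs S * ?n)" unfolding q by (simp only: of_nat_less_iff) simp
  moreover have "nat ?q = r * ?n + i" by (simp only: q nat_int)
  ultimately show ?thesis using assms unfolding input_store_def Let_def
    by (simp add: rows_of_def)
qed

lemma search_system:
  assumes wf: "wf_system S" and D: "D = min (2 * k) (num_vars S)"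
    and L: "2 * num_vars S + num_eqs S + 1 \<le> L"
  shows "search (num_vars S) (num_eqs S) L k (rows_of S) (signs_of S) D"
proof
  show "elimination.bounded_rows (num_vars S) (num_eqs S) (rows_of S)"
    unfolding elimination.bounded_rows_def
  proof (intro allI impI subsetI)
    fix r i assume "r < num_eqs S + num_vars S" "i \<in> rows_of S r"
    then show "i \<in> {..<num_vars S}"
      using wf_equation(2)[OF wf, of r] by (cases "r < num_eqs S") (auto simp: rows_of_def)
  qed
  show "signs (signs_of S)" using wf_equation(3)[OF wf] by (auto simp: signs_def signs_of_def)
qed (use assms in \<open>auto simp: rows_of_def signs_of_def\<close>)

lemma val_rows_of:
  assumes "wf_system S" "r < num_eqs S"
  shows "val (rows_of S) (signs_of S) y r =
    rhs (equations S ! r) * (\<Prod>i\<in>lhs_vars (equations S ! r). y (i - 1))"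
  using assms(2) unfolding val_def lhs_vars_rows_of[OF assms]
  by (simp add: prod.reindex signs_of_def)

lemma val_unit_row: "val (rows_of S) (signs_of S) y (num_eqs S + i) = y i"
  by (simp add: val_def rows_of_def signs_of_def)

lemma excess_eq_total:
  assumes wf: "wf_system S" and y: "\<And>i. i \<in> {1..num_vars S} \<Longrightarrow> x i = y (i - 1)"
  shows "excess S x = elimination.total (num_eqs S) (\<lambda>j. weight (equations S ! j))
    (val (rows_of S) (signs_of S) y)"
  unfolding excess_def elimination.total_def
proof (rule sum.cong)
  fix j assume "j \<in> {..<num_eqs S}"
  then have j: "j < num_eqs S" by simp
  have "(\<Prod>i\<in>lhs_vars (equations S ! j). x i) = (\<Prod>i\<in>lhs_vars (equations S ! j). y (i - 1))"
    using wf_equation(2)[OF wf j] y by (intro prod.cong) auto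
  then show "weight (equations S ! j) * rhs (equations S ! j) * (\<Prod>i\<in>lhs_vars (equations S ! j). x i) =
      weight (equations S ! j) * val (rows_of S) (signs_of S) y j"
    by (simp add: val_rows_of[OF wf j])
qed simp

theorem theorem1:
  "\<exists>(P :: com) (c :: nat). \<forall>(S :: lin_system) (k :: nat). wf_system S \<longrightarrow>
     (\<exists>(t :: nat) (s :: store).
        exec P (input_store S k) t s \<and>
        t \<le> c * max 1 (num_vars S) ^ (2 * k) * (max 1 (num_vars S) * max 1 (num_eqs S)) ^ c \<and>
        (if \<exists>x. is_assignment S x \<and> excess S x \<ge> 2 * int k
         then \<exists>x0. answer s = Some x0 \<and> is_assignment S x0 \<and> excess S x0 \<ge> 2 * int k
         else answer s = None))"
proof -
  obtain C1 a1 where C1: "\<forall>L\<ge>1. tcost L setup_arrays \<le> C1 * L ^ a1"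
    using tcost_polynomial by blast
  obtain C2 a2 where C2: "\<forall>L\<ge>1. tcost L try_choices \<le> C2 * L ^ a2"
    using tcost_polynomial by blast
  \<comment> \<open>One number \<open>c\<close> has to serve as factor and as exponent, hence the
    sum defining it. The power of 4 comes from \<open>L = 4 * B\<close>, and the 10 in
    \<open>K\<close> is twice the guard cost 5.\<close>
  define e K where "e = a1 + a2" and "K = C1 + C2 + 10"
  define c where "c = K * 4 ^ e + e"
  have "\<exists>t s. exec search_program (input_store S k) t s \<and>
        t \<le> c * max 1 (num_vars S) ^ (2 * k) * (max 1 (num_vars S) * max 1 (num_eqs S)) ^ c \<and>
        (if \<exists>x. is_assignment S x \<and> excess S x \<ge> 2 * int k
         then \<exists>x0. answer s = Some x0 \<and> is_assignment S x0 \<and> excess S x0 \<ge> 2 * int k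
         else answer s = None)" if wf: "wf_system S" for S k
  proof -
    define n m D where "n = num_vars S" and "m = num_eqs S" and "D = min (2 * k) n"
    define B where "B = max 1 n * max 1 m"
    have B1: "1 \<le> B" by (simp add: B_def)
    have "max 1 n * 1 \<le> B" "1 * max 1 m \<le> B"
      unfolding B_def by (rule mult_le_mono2, simp, rule mult_le_mono1, simp)
    then have Bn: "n \<le> B" and Bm: "m \<le> B" by simp_all
    \<comment> \<open>\<open>2 * n + m + 1\<close> is a sum of four terms, each at most
      \<open>B\<close>.\<close>
    have L: "2 * n + m + 1 \<le> 4 * B" using B1 Bn Bm by linarith
    interpret search n m "\<lambda>j. weight (equations S ! j)" "4 * B" k "rows_of S" "signs_of S" D
      using search_system[OF wf] L by (simp add: n_def m_def D_def)
    have "inputs (input_store S k)"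
      unfolding inputs_def unfolding n_def m_def
      by (auto simp: input_store_matrix) (simp add: input_store_def signs_of_def Let_def)
    then obtain t s where run: "exec search_program (input_store S k) t s"
      and t: "t \<le> tcost (4 * B) setup_arrays + 5 + n ^ D * (5 + tcost (4 * B) try_choices)"
      and inv: "invariant (n ^ D) s"
      using exec_search[of "input_store S k"]
      by (auto simp: input_store_def Let_def n_def m_def fun_eq_iff)
    have "t \<le> c * max 1 n ^ (2 * k) * B ^ c"
    proof -
      let ?M = "max 1 n ^ (2 * k)" and ?L = "(4 * B) ^ e"
      have M: "n ^ D \<le> ?M" "1 \<le> ?M"
      proof -
        have "n ^ D \<le> max 1 n ^ D" by (rule power_mono) auto
        also have "\<dots> \<le> ?M" by (rule power_increasing) (auto simp: D_def)
        finally show "n ^ D \<le> ?M" .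
      qed simp
      have L1: "1 \<le> 4 * B" using B1 by simp
      have "(4 * B) ^ a1 \<le> ?L" "(4 * B) ^ a2 \<le> ?L"
        by (rule power_increasing[OF _ L1], simp add: e_def)+
      moreover have "1 \<le> ?L" using L1 by (rule one_le_power)
      ultimately have T: "tcost (4 * B) setup_arrays \<le> C1 * ?L" "tcost (4 * B) try_choices \<le> C2 * ?L" "1 \<le> ?L"
        using C1[rule_format, OF L1] C2[rule_format, OF L1] by (meson le_trans mult_le_mono2)+
      have "t \<le> (C1 * ?L + 5 * ?L) + ?M * (5 * ?L + C2 * ?L)"
        by (rule order.trans[OF t]) (use T M in \<open>intro add_mono mult_mono; simp\<close>)
      also have "\<dots> = (C1 + 5) * ?L * 1 + ?M * (5 * ?L + C2 * ?L)" by (simp add: algebra_simps)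
      also have "\<dots> \<le> (C1 + 5) * ?L * ?M + ?M * (5 * ?L + C2 * ?L)"
        using M(2) by (intro add_mono mult_le_mono2) auto
      also have "\<dots> = (K * 4 ^ e) * ?M * B ^ e" by (simp add: K_def algebra_simps power_mult_distrib)
      also have "\<dots> \<le> c * ?M * B ^ c"
        using B1 by (intro mult_mono power_increasing) (auto simp: c_def)
      finally show ?thesis .
    qed
    moreover have "if \<exists>x. is_assignment S x \<and> excess S x \<ge> 2 * int k
         then \<exists>x0. answer s = Some x0 \<and> is_assignment S x0 \<and> excess S x0 \<ge> 2 * int k
         else answer s = None"
    proof (cases "s ''found'' 0 = 0")
      case True
      have "\<not> (is_assignment S x \<and> excess S x \<ge> 2 * int k)" for x
      proof
        assume x: "is_assignment S x \<and> excess S x \<ge> 2 * int k"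
        \<comment> \<open>Renumbering from 0; the filler 1 beyond \<open>n\<close> makes
          \<open>y\<close> a sign vector on all of \<open>nat\<close>.\<close>
        define y where "y p = (if p < n then x (Suc p) else 1)" for p
        have y: "signs y" using x by (auto simp: signs_def y_def is_assignment_def n_def)
        define z where "z = val (rows_of S) (signs_of S) y"
        have "reach (rows_of S) (signs_of S) z" using y unfolding reach_def z_def by blast
        moreover have "excess S x = total z" unfolding z_def m_def
          by (rule excess_eq_total[OF wf]) (auto simp: y_def n_def)
        then have "int (2 * k) \<le> total z" using x by simp
        \<comment> \<open>No original left-hand side is empty, so the constant term is in fact
          0.\<close>
        moreover have "coef (rows_of S) (signs_of S) {} \<ge> 0"
        proof -
          have "rows_of S r \<noteq> {}" if "r < m" for r
            using that wf_equation(1)[OF wf, of r] lhs_vars_rows_of[OF wf, of r] by (auto simp: m_def)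
          then show ?thesis using coef_nonzero[of "rows_of S" "signs_of S" "{}"] by fastforce
        qed
        ultimately obtain d u where d: "\<forall>i<D. d i < n" and
          u: "u \<le> D + n" "int (2 * k) \<le> total (outcome d u)"
          using complete[OF _ _ _ D] by blast
        from digits_exist[OF d] obtain a where a: "a < n ^ D" "\<forall>i<D. digit n a i = d i" by blast
        \<comment> \<open>Only the first \<open>D\<close> digits matter, so \<open>d\<close> may be
          replaced by the digits of \<open>a\<close>, whose trial is on record as a failure.\<close>
        have "outcome (digit n a) u = outcome d u"
          using a(2) state_cong[of u "digit n a" d] by (simp add: outcome_def)
        moreover have "total (outcome (digit n a) u) < int (2 * k)"
          using inv True a(1) u(1) unfolding invariant_def by (simp add: less_Suc_eq_le)
        ultimately show False using u(2) by simp
      qed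
      then show ?thesis using True by (simp add: answer_def)
    next
      case False
      then obtain z where z: "reach (rows_of S) (signs_of S) z" "int (2 * k) \<le> total z"
        "\<forall>i<n. s ''x'' (int i + 1) = z (m + i)"
        using inv by (auto simp: invariant_def sound_def)
      then obtain y where y: "signs y" "\<forall>r<m+n. z r = val (rows_of S) (signs_of S) y r"
        by (auto simp: reach_def)
      let ?x = "\<lambda>i. s ''x'' (int i)"
      have x: "?x i = y (i - 1)" if "i \<in> {1..n}" for i
      proof -
        have "i - 1 < n" "int (i - 1) + 1 = int i" using that by auto
        then have "?x i = z (m + (i - 1))" using z(3) by metis
        then show ?thesis using y(2) \<open>i - 1 < n\<close> val_unit_row[of S y "i - 1"] by (simp add: m_def)
      qed
      have "is_assignment S ?x" unfolding is_assignment_def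
      proof
        fix i assume "i \<in> {1..num_vars S}"
        then have "?x i = y (i - 1)" using x by (simp add: n_def)
        then show "?x i \<in> {-1, 1}" using y(1) by (auto simp: signs_def)
      qed
      moreover have "excess S ?x = total z"
        using excess_eq_total[OF wf, of ?x y] x y(2) total_reach_cong[of z "val (rows_of S) (signs_of S) y"]
        by (simp add: m_def n_def)
      then have "excess S ?x \<ge> 2 * int k" using z(2) by simp
      moreover have "answer s = Some ?x" using False by (simp add: answer_def)
      ultimately show ?thesis by auto
    qed
    ultimately show ?thesis using run unfolding B_def n_def m_def by blast
  qed
  then show ?thesis by blast
qed

end
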